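(* Let $\mathcal{A}$ be a finite alphabet, $\Omega=\mathcal{A}^{\mathbb{N}}$ with the Borel $\sigma$-algebra generated by cylinders, $\sigma$ the shift, and $\mu$ a $\sigma$-invariant Borel probability measure on $\Omega$ (not necessarily ergodic). If $Z:\mathcal{A}^*\to\{0,1\}^*$ is an optimal reversible coding algorithm, then the functions $K_Z$, $\hat H$, $K$ are measurable and $$h_\mu(\sigma)=\int_\Omega K_Z(\omega)\,d\mu=\int_\Omega\hat H(\omega)\,d\mu=\int_\Omega K(\omega)\,d\mu.$$
   Context: $\omega^n$ is the string of the first $n$ symbols of $\omega$; $h_\mu(\sigma)$ is the Kolmogorov–Sinai entropy. Empirical entropy: for a finite string $s$ of length $n$ and $w\in\mathcal{A}^l$, $P(s,w)=\frac{1}{n-l+1}\#\{0\le i\le n-l: s_{i+1}\cdots s_{i+l}=w\}$, $\hat H_l(s)=-\frac1l\sum_{w}P(s,w)\log_2P(s,w)$; $\hat H_l(\omega)=\limsup_n\hat H_l(\omega^n)$, $\hat H(\omega)=\lim_{l}\hat H_l(\omega)$. A reversible coding algorithm is an injective recursive $Z:\mathcal{A}^*\to\{0,1\}^*$; it is optimal if for every $k$ there is $f_k$ with $f_k(n)=o(n)$ such that $|Z(s)|/|s|\le\hat H_k(s)+f_k(|s|)/|s|$ for all finite $s$. $K_Z(\omega)=\limsup_n|Z(\omega^n)|/n$. $AIC(s)=\min\{|P|:C(P)=s\}$ for a fixed universal machine $C$, and $K(\omega)=\limsup_n AIC(\omega^n)/n$. *)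

theory Defs
  imports "HOL-Probability.Probability" "HOL-Library.Landau_Symbols"
          "HOL-Library.Nat_Bijection" "HOL-Library.Countable"
begin

datatype recf = RZ | RS | RId nat | RCn recf "recf list" | RPr recf recf | RMn recf

inductive reval :: "recf \<Rightarrow> nat list \<Rightarrow> nat \<Rightarrow> bool" where
  zero: "reval RZ xs 0"
| succ: "reval RS (x # xs) (Suc x)"
| proj: "i < length xs \<Longrightarrow> reval (RId i) xs (xs ! i)"
| comp: "length ys = length gs \<Longrightarrow> (\<forall>i < length gs. reval (gs ! i) xs (ys ! i))
          \<Longrightarrow> reval f ys r \<Longrightarrow> reval (RCn f gs) xs r"
| pr0: "reval f xs r \<Longrightarrow> reval (RPr f g) (0 # xs) r"
| prS: "reval (RPr f g) (n # xs) r \<Longrightarrow> reval g (n # r # xs) r'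
          \<Longrightarrow> reval (RPr f g) (Suc n # xs) r'"
| mn: "reval f (n # xs) 0 \<Longrightarrow> (\<forall>m < n. \<exists>k. reval f (m # xs) (Suc k))
          \<Longrightarrow> reval (RMn f) xs n"

definition enc_str :: "'a::countable list \<Rightarrow> nat" where
  "enc_str s = list_encode (map to_nat s)"

definition enc_bits :: "bool list \<Rightarrow> nat" where
  "enc_bits p = list_encode (map of_bool p)"

definition recursive_fun :: "('a::countable list \<Rightarrow> bool list) \<Rightarrow> bool" where
  "recursive_fun Z \<longleftrightarrow> (\<exists>f. \<forall>s. reval f [enc_str s] (enc_bits (Z s)))"

definition partial_recursive_machine :: "(bool list \<Rightarrow> 'a::countable list option) \<Rightarrow> bool" where
  "partial_recursive_machine M \<longleftrightarrow>
     (\<exists>f. \<forall>p y. reval f [enc_bits p] y \<longleftrightarrow> (\<exists>s. M p = Some s \<and> enc_str s = y))"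

definition universal_machine :: "(bool list \<Rightarrow> 'a::countable list option) \<Rightarrow> bool" where
  "universal_machine C \<longleftrightarrow> partial_recursive_machine C \<and>
     (\<forall>M. partial_recursive_machine M \<longrightarrow> (\<exists>q. \<forall>p. C (q @ p) = M p))"

definition prefix_of :: "(nat \<Rightarrow> 'a) \<Rightarrow> nat \<Rightarrow> 'a list" where
  "prefix_of \<omega> n = map \<omega> [0..<n]"

definition shift :: "(nat \<Rightarrow> 'a) \<Rightarrow> (nat \<Rightarrow> 'a)" where
  "shift \<omega> = (\<lambda>i. \<omega> (Suc i))"

definition emp_freq :: "'a list \<Rightarrow> 'a list \<Rightarrow> real" where
  "emp_freq s w = real (card {i. i + length w \<le> length s \<and> take (length w) (drop i s) = w})
                   / (real (length s) - real (length w) + 1)"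

definition emp_entropy :: "nat \<Rightarrow> 'a::finite list \<Rightarrow> real" where
  "emp_entropy l s = - (1 / real l) *
     (\<Sum>w\<in>{w. length w = l}. emp_freq s w * log 2 (emp_freq s w))"

definition emp_entropy_seq_l :: "nat \<Rightarrow> (nat \<Rightarrow> 'a::finite) \<Rightarrow> real" where
  "emp_entropy_seq_l l \<omega> = real_of_ereal (limsup (\<lambda>n. ereal (emp_entropy l (prefix_of \<omega> n))))"

definition emp_entropy_seq :: "(nat \<Rightarrow> 'a::finite) \<Rightarrow> real" where
  "emp_entropy_seq \<omega> = lim (\<lambda>l. emp_entropy_seq_l l \<omega>)"

definition reversible_coding :: "('a::countable list \<Rightarrow> bool list) \<Rightarrow> bool" where
  "reversible_coding Z \<longleftrightarrow> inj Z \<and> recursive_fun Z"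

definition optimal_coding :: "('a::finite list \<Rightarrow> bool list) \<Rightarrow> bool" where
  "optimal_coding Z \<longleftrightarrow> reversible_coding Z \<and>
     (\<forall>k\<ge>1. \<exists>f :: nat \<Rightarrow> real. f \<in> o(\<lambda>n. real n) \<and>
        (\<forall>s. real (length (Z s)) / real (length s)
               \<le> emp_entropy k s + f (length s) / real (length s)))"

definition K_Z :: "('a list \<Rightarrow> bool list) \<Rightarrow> (nat \<Rightarrow> 'a) \<Rightarrow> real" where
  "K_Z Z \<omega> = real_of_ereal (limsup (\<lambda>n. ereal (real (length (Z (prefix_of \<omega> n))) / real n)))"

definition AIC :: "(bool list \<Rightarrow> 'a list option) \<Rightarrow> 'a list \<Rightarrow> nat" where
  "AIC C s = (LEAST m. \<exists>p. C p = Some s \<and> length p = m)"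

definition K_AIC :: "(bool list \<Rightarrow> 'a list option) \<Rightarrow> (nat \<Rightarrow> 'a) \<Rightarrow> real" where
  "K_AIC C \<omega> = real_of_ereal (limsup (\<lambda>n. ereal (real (AIC C (prefix_of \<omega> n)) / real n)))"

definition finite_meas_partition :: "'b measure \<Rightarrow> 'b set set \<Rightarrow> bool" where
  "finite_meas_partition M P \<longleftrightarrow> finite P \<and> P \<subseteq> sets M \<and> \<Union>P = space M \<and>
     (\<forall>A\<in>P. \<forall>B\<in>P. A \<noteq> B \<longrightarrow> A \<inter> B = {})"

definition partition_entropy :: "'b measure \<Rightarrow> 'b set set \<Rightarrow> real" where
  "partition_entropy M P = - (\<Sum>A\<in>P. measure M A * log 2 (measure M A))"

definition iter_join :: "'b measure \<Rightarrow> ('b \<Rightarrow> 'b) \<Rightarrow> 'b set set \<Rightarrow> nat \<Rightarrow> 'b set set" where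
  "iter_join M T P n = {A. A \<noteq> {} \<and> (\<exists>f. (\<forall>i<n. f i \<in> P) \<and>
       A = space M \<inter> (\<Inter>i\<in>{..<n}. (T ^^ i) -` f i))}"

definition entropy_wrt_partition :: "'b measure \<Rightarrow> ('b \<Rightarrow> 'b) \<Rightarrow> 'b set set \<Rightarrow> real" where
  "entropy_wrt_partition M T P = lim (\<lambda>n. partition_entropy M (iter_join M T P n) / real n)"

definition ks_entropy :: "'b measure \<Rightarrow> ('b \<Rightarrow> 'b) \<Rightarrow> ereal" where
  "ks_entropy M T = (SUP P\<in>{P. finite_meas_partition M P}. ereal (entropy_wrt_partition M T P))"

end

theory Submission
  imports Defs
begin

text \<open>Pointwise, \<open>K \<le> K\<^sub>Z\<close> because \<open>Z\<close> has a partial recursive inverse, and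
  \<open>K\<^sub>Z\<close> is at most every empirical block entropy rate by optimality, hence at most their
  limit. By Birkhoff's theorem almost every sequence has limiting word frequencies, which are
  stationary weights averaging to the distribution of words under \<open>\<mu>\<close>; concavity of
  \<open>- x log x\<close> bounds the integral of the empirical entropy by the entropy rate of the
  coordinate process, without any ergodic decomposition. Conversely shortest programs are an
  injective code, so up to a logarithmic term their mean length is at least the block entropy,
  and the reverse Fatou lemma bounds the entropy rate by the integral of \<open>K\<close>. Finally the
  entropy rate is \<open>h\<^sub>\<mu>\<close> because any finite partition agrees, off a set of small measure,
  with one into cylinder sets.\<close>

section \<open>Entropy of finite distributions\<close>

text \<open>The inequalities close up in a cycle: with h the entropy rate of \<open>first\<close>, h
  \<le> \<integral>K \<le> \<integral>K_Z \<le> \<integral>H \<le> h. Each link is one-sided, and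
  the lower bound on complexity is proved only in the mean. Two obstacles shape the details. Limits
  are totalised: \<open>real_of_ereal\<close> sends an infinite limsup to 0, and \<open>lim\<close>
  is unspecified where there is no limit. Hence explicit bounds accompany every limsup, and
  \<open>emp_entropy_seq\<close> is estimated at generic sequences only. Moreover, programs need not
  be prefix-free, so the weights 2^-length of a code may sum to more than 1. They are normalised by
  the number of possible lengths, which is linear in n for codes of linear length, so that its
  logarithm vanishes after division by n. The limiting frequencies of a single sequence are treated
  as abstract weights on words (\<open>stationary_weights\<close>), so that entropy arguments apply
  to each sequence without building a measure from it.\<close>

definition eta :: "real \<Rightarrow> real" where
  "eta x = - (x * log 2 x)"

lemma eta_0 [simp]: "eta 0 = 0" and eta_1 [simp]: "eta 1 = 0"
  by (simp_all add: eta_def)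

lemma eta_nonneg: "0 \<le> x \<Longrightarrow> x \<le> 1 \<Longrightarrow> 0 \<le> eta x"
  by (cases "x = 0") (auto simp: eta_def mult_nonneg_nonpos)

text \<open>As a function of \<open>p\<close>, the right-hand side is the tangent line of the
  concave function \<open>eta\<close> at \<open>q\<close>. Concavity is always used in this form:
  for Gibbs' and Jensen's inequalities, and with \<open>q = 1\<close> for
  \<open>eta x \<le> (1 - x) / ln 2\<close>.\<close>

lemma eta_le_cross:
  fixes p q :: real
  assumes "0 \<le> p" "0 \<le> q" "p > 0 \<Longrightarrow> q > 0"
  shows "eta p \<le> - (p * log 2 q) + (q - p) / ln 2"
proof (cases "p = 0")
  case True
  then show ?thesis using assms by simp
next
  case False
  with assms have p: "p > 0" "q > 0" by auto
  have "ln (q / p) \<le> q / p - 1"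
    using p by (intro ln_le_minus_one) auto
  then have "p * ln (q / p) \<le> p * (q / p - 1)"
    using p by (intro mult_left_mono) auto
  then have "p * ln q - p * ln p \<le> q - p"
    using p by (simp add: ln_div algebra_simps)
  then have "(p * ln q - p * ln p) / ln 2 \<le> (q - p) / ln 2"
    by (intro divide_right_mono) auto
  then show ?thesis
    by (simp add: eta_def log_def diff_divide_distrib)
qed

lemma eta_le: "0 \<le> x \<Longrightarrow> eta x \<le> 1 / ln 2"
  using eta_le_cross[of x 1] by (simp add: diff_divide_distrib) (smt (verit) divide_nonneg_pos ln_gt_zero)

text \<open>The endpoint 0 has to be included: a word that occurs in a sequence may still have
  limiting frequency 0.\<close>

lemma continuous_on_eta: "continuous_on {0..} eta"
proof (rule continuous_on_eq_continuous_within[THEN iffD2], rule ballI)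
  fix x :: real assume "x \<in> {0..}"
  then consider "x = 0" | "0 < x" by fastforce
  then show "continuous (at x within {0..}) eta"
  proof cases
    case 1
    have "(eta \<longlongrightarrow> 0) (at_right 0)"
      unfolding eta_def[abs_def] log_def by real_asymp
    with 1 show ?thesis by (simp add: continuous_within at_within_Ici_at_right)
  next
    case 2
    then have "isCont eta x"
      unfolding eta_def[abs_def] by (intro continuous_intros) auto
    then show ?thesis by (rule continuous_at_imp_continuous_at_within)
  qed
qed

lemma tendsto_eta: "f \<longlonglongrightarrow> L \<Longrightarrow> (\<And>n. 0 \<le> f n) \<Longrightarrow> (\<lambda>n. eta (f n)) \<longlonglongrightarrow> eta L"
  by (rule continuous_on_tendsto_compose[OF continuous_on_eta]) (auto intro: LIMSEQ_le_const)

lemma borel_measurable_eta [measurable]: "eta \<in> borel_measurable borel"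
  unfolding eta_def[abs_def] by measurable

text \<open>Summing the tangent inequality leaves the error
  \<open>(sum q S - sum p S) / ln 2\<close>, which is not positive. Allowing \<open>q\<close> a
  smaller total mass than \<open>p\<close> accommodates code weights.\<close>

lemma gibbs_inequality:
  assumes "\<And>x. x \<in> S \<Longrightarrow> 0 \<le> p x" "\<And>x. x \<in> S \<Longrightarrow> 0 \<le> q x"
    and "\<And>x. x \<in> S \<Longrightarrow> p x > 0 \<Longrightarrow> q x > 0"
    and "sum q S \<le> sum p S"
  shows "(\<Sum>x\<in>S. eta (p x)) \<le> - (\<Sum>x\<in>S. p x * log 2 (q x))"
proof -
  have "(\<Sum>x\<in>S. eta (p x)) \<le> (\<Sum>x\<in>S. - (p x * log 2 (q x)) + (q x - p x) / ln 2)"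
    using assms by (intro sum_mono eta_le_cross) auto
  also have "\<dots> = - (\<Sum>x\<in>S. p x * log 2 (q x)) + (sum q S - sum p S) / ln 2"
    by (simp add: sum.distrib sum_negf sum_subtractf flip: sum_divide_distrib)
  also have "\<dots> \<le> - (\<Sum>x\<in>S. p x * log 2 (q x))"
    using assms(4) by (simp add: divide_nonpos_pos)
  finally show ?thesis .
qed

text \<open>Gibbs' inequality against the weights \<open>2\<close> to the minus code length, which for a merely injective
  (not prefix-free) code sum to at most the number of possible lengths.\<close>

lemma entropy_le_code_length:
  fixes c :: "'x \<Rightarrow> bool list"
  assumes fin: "finite S" and inj: "inj_on c S" and D: "\<And>x. x \<in> S \<Longrightarrow> length (c x) \<le> D"
    and p: "\<And>x. x \<in> S \<Longrightarrow> 0 \<le> p x" "sum p S = 1"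
  shows "(\<Sum>x\<in>S. eta (p x)) \<le> (\<Sum>x\<in>S. p x * real (length (c x))) + log 2 (real D + 1)"
proof -
  define q where "q x = (1/2) ^ length (c x) / (real D + 1)" for x
  have fin': "finite {b :: bool list. length b = m}" and card: "card {b :: bool list. length b = m} = 2 ^ m" for m
    using finite_lists_length_eq[of "UNIV :: bool set" m] card_lists_length_eq[of "UNIV :: bool set" m] by simp_all
  have "(\<Sum>x\<in>S. (1/2::real) ^ length (c x)) = (\<Sum>b\<in>c ` S. (1/2::real) ^ length b)"
    by (simp add: sum.reindex[OF inj])
  also have "\<dots> \<le> (\<Sum>b\<in>(\<Union>m\<in>{..D}. {b :: bool list. length b = m}). (1/2::real) ^ length b)"
    by (rule sum_mono2) (use D fin' in auto)
  also have "\<dots> = (\<Sum>m\<in>{..D}. \<Sum>b\<in>{b::bool list. length b = m}. (1/2::real) ^ length b)"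
    by (rule sum.UNION_disjoint) (use fin' in auto)
  \<comment> \<open>There are 2^m bit strings of length m, each of weight 2^-m.\<close>
  also have "\<dots> = (\<Sum>m\<in>{..D}. 1)"
    by (rule sum.cong) (auto simp: card power_divide)
  finally have "(\<Sum>x\<in>S. (1/2::real) ^ length (c x)) \<le> real D + 1" by simp
  then have "sum q S \<le> 1"
    by (simp add: q_def flip: sum_divide_distrib)
  then have cross: "(\<Sum>x\<in>S. eta (p x)) \<le> - (\<Sum>x\<in>S. p x * log 2 (q x))"
    using p by (intro gibbs_inequality) (auto simp: q_def)
  have logq: "log 2 (q x) = - real (length (c x)) - log 2 (real D + 1)" for x
  proof -
    have "real D + 1 \<noteq> 0" by (metis of_nat_Suc of_nat_neq_0 add.commute)
    then have "log 2 (q x) = log 2 ((1/2) ^ length (c x)) - log 2 (real D + 1)"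
      unfolding q_def by (simp add: log_divide)
    moreover have "log 2 ((1/2) ^ length (c x)) = - real (length (c x))"
      by (simp add: log_nat_power log_divide)
    ultimately show ?thesis by simp
  qed
  have "(\<Sum>x\<in>S. p x * log 2 (q x)) = (\<Sum>x\<in>S. - (p x * real (length (c x))) - p x * log 2 (real D + 1))"
    by (intro sum.cong refl) (simp only: logq algebra_simps)
  also have "\<dots> = - (\<Sum>x\<in>S. p x * real (length (c x))) - log 2 (real D + 1)"
    using p(2) by (simp add: sum_subtractf sum_negf flip: sum_distrib_right)
  finally show ?thesis using cross by simp
qed

text \<open>Subadditivity of entropy: Gibbs' inequality for a joint distribution against the product
  of its marginals.\<close>

lemma joint_eta_le:
  assumes fin: "finite A" "finite B"
    and nn: "\<And>x y. x \<in> A \<Longrightarrow> y \<in> B \<Longrightarrow> 0 \<le> P x y"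
    and one: "(\<Sum>x\<in>A. \<Sum>y\<in>B. P x y) = 1"
  shows "(\<Sum>x\<in>A. \<Sum>y\<in>B. eta (P x y)) \<le> (\<Sum>x\<in>A. eta (\<Sum>y\<in>B. P x y)) + (\<Sum>y\<in>B. eta (\<Sum>x\<in>A. P x y))"
proof -
  define f where "f x = (\<Sum>y\<in>B. P x y)" for x
  define g where "g y = (\<Sum>x\<in>A. P x y)" for y
  have f0: "x \<in> A \<Longrightarrow> 0 \<le> f x" for x by (auto simp: f_def intro!: sum_nonneg nn)
  have g0: "y \<in> B \<Longrightarrow> 0 \<le> g y" for y by (auto simp: g_def intro!: sum_nonneg nn)
  have fP: "P x y \<le> f x" if "x \<in> A" "y \<in> B" for x y
    using that fin unfolding f_def by (intro member_le_sum) (auto intro: nn)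
  have gP: "P x y \<le> g y" if "x \<in> A" "y \<in> B" for x y
    using that fin unfolding g_def by (intro member_le_sum[of x A "\<lambda>x. P x y"]) (auto intro: nn)
  have f1: "sum f A = 1" using one by (simp add: f_def)
  have g1: "sum g B = 1" using one unfolding g_def by (subst sum.swap) simp
  have "(\<Sum>x\<in>A. \<Sum>y\<in>B. eta (P x y)) = (\<Sum>z\<in>A \<times> B. eta (P (fst z) (snd z)))"
    by (simp add: sum.cartesian_product split_beta)
  also have "\<dots> \<le> - (\<Sum>z\<in>A \<times> B. P (fst z) (snd z) * log 2 (f (fst z) * g (snd z)))"
  proof (rule gibbs_inequality)
    fix z assume z: "z \<in> A \<times> B"
    then show "0 \<le> P (fst z) (snd z)" "0 \<le> f (fst z) * g (snd z)"
      by (auto intro!: mult_nonneg_nonneg intro: nn f0 g0)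
    assume "0 < P (fst z) (snd z)"
    then show "0 < f (fst z) * g (snd z)"
      using z fP gP by (auto intro!: mult_pos_pos intro: less_le_trans)
  next
    have "(\<Sum>z\<in>A \<times> B. f (fst z) * g (snd z)) = sum f A * sum g B"
      by (simp add: sum_product sum.cartesian_product split_beta)
    also have "\<dots> = (\<Sum>z\<in>A \<times> B. P (fst z) (snd z))"
      using one f1 g1 by (simp add: sum.cartesian_product split_beta)
    finally show "(\<Sum>z\<in>A \<times> B. f (fst z) * g (snd z)) \<le> (\<Sum>z\<in>A \<times> B. P (fst z) (snd z))" by simp
  qed
  also have "(\<Sum>z\<in>A \<times> B. P (fst z) (snd z) * log 2 (f (fst z) * g (snd z)))
     = (\<Sum>z\<in>A \<times> B. P (fst z) (snd z) * log 2 (f (fst z)) + P (fst z) (snd z) * log 2 (g (snd z)))"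
  proof (rule sum.cong, simp)
    fix z assume z: "z \<in> A \<times> B"
    show "P (fst z) (snd z) * log 2 (f (fst z) * g (snd z)) =
      P (fst z) (snd z) * log 2 (f (fst z)) + P (fst z) (snd z) * log 2 (g (snd z))"
    \<comment> \<open>The logarithm of the product is split for positive marginals; where the joint
      weight is 0, both sides vanish.\<close>
    proof (cases "P (fst z) (snd z) = 0")
      case False
      then have "P (fst z) (snd z) > 0" using z nn[of "fst z" "snd z"] by auto
      then have "f (fst z) > 0" "g (snd z) > 0"
        using fP[of "fst z" "snd z"] gP[of "fst z" "snd z"] z by auto
      then show ?thesis by (simp add: log_mult algebra_simps)
    qed simp
  qed
  also have "\<dots> = (\<Sum>x\<in>A. \<Sum>y\<in>B. P x y * log 2 (f x)) + (\<Sum>x\<in>A. \<Sum>y\<in>B. P x y * log 2 (g y))"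
    by (simp add: sum.distrib sum.cartesian_product split_beta)
  also have "(\<Sum>x\<in>A. \<Sum>y\<in>B. P x y * log 2 (g y)) = (\<Sum>y\<in>B. \<Sum>x\<in>A. P x y * log 2 (g y))"
    by (rule sum.swap)
  finally show ?thesis
    by (simp add: eta_def sum_negf flip: f_def g_def sum_distrib_right)
qed

text \<open>Fekete's lemma: the limit is the infimum of \<open>a n / n\<close>. Choose
  \<open>k\<close> nearly attaining it and divide \<open>n\<close> by \<open>k\<close> with
  remainder. Nonnegativity keeps the infimum finite and allows \<open>n div k\<close> to be replaced
  by \<open>n / k\<close>.\<close>

lemma subadditive_limit:
  fixes a :: "nat \<Rightarrow> real"
  assumes nn: "\<And>n. 0 \<le> a n" and sub: "\<And>m n. a (m + n) \<le> a m + a n"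
  shows "\<exists>L. (\<lambda>n. a n / real n) \<longlonglongrightarrow> L \<and> (\<forall>n\<ge>1. L \<le> a n / real n)"
proof -
  define S where "S = (\<lambda>n. a n / real n) ` {1..}"
  define L where "L = Inf S"
  have bdd: "bdd_below S" by (rule bdd_belowI[of _ 0]) (auto simp: S_def nn)
  have ne: "S \<noteq> {}" by (auto simp: S_def)
  have lower: "L \<le> a n / real n" if "n \<ge> 1" for n
    unfolding L_def using bdd that by (intro cInf_lower) (auto simp: S_def)
  have mult: "a (q * k + r) \<le> real q * a k + a r" for q k r
  proof (induction q)
    case (Suc q)
    have "a (Suc q * k + r) = a (k + (q * k + r))" by (simp add: algebra_simps)
    also have "\<dots> \<le> a k + a (q * k + r)" by (rule sub)
    finally show ?case using Suc by (simp add: algebra_simps)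
  qed simp
  have "(\<lambda>n. a n / real n) \<longlonglongrightarrow> L"
  proof (rule LIMSEQ_I)
    fix r :: real assume r: "0 < r"
    have "\<exists>x\<in>S. x < L + r/2"
      using r ne bdd cInf_lessD[of S "L + r/2"] unfolding L_def by auto
    then obtain k where k: "k \<ge> 1" "a k / real k < L + r/2" by (auto simp: S_def)
    \<comment> \<open>A common bound for all the remainder terms \<open>a (n mod k)\<close>.\<close>
    define C where "C = (\<Sum>i<k. a i)"
    have C: "a i \<le> C" if "i < k" for i
      unfolding C_def using that nn by (intro member_le_sum) auto
    have C0: "0 \<le> C" unfolding C_def by (intro sum_nonneg nn)
    obtain N where N: "real N > C / (r/2)" using reals_Archimedean2 by blast
    show "\<exists>no. \<forall>n\<ge>no. norm (a n / real n - L) < r"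
    proof (intro exI allI impI)
      fix n assume n: "n \<ge> max 1 N"
      have "a n = a (n div k * k + n mod k)" by simp
      also have "\<dots> \<le> real (n div k) * a k + a (n mod k)" by (rule mult)
      also have "\<dots> \<le> real (n div k) * a k + C" using k C by simp
      also have "real (n div k) * a k \<le> (real n / real k) * a k"
        by (intro mult_right_mono nn of_nat_div_le_of_nat)
      finally have "a n / real n \<le> (real n / real k * a k + C) / real n"
        by (intro divide_right_mono) auto
      also have "\<dots> = a k / real k + C / real n"
        using n k by (simp add: field_simps)
      also have "C / real n < r / 2"
      proof -
        have "C < real N * (r/2)" using N r by (simp add: field_simps)
        also have "\<dots> \<le> real n * (r/2)" using n r by (intro mult_right_mono) auto
        finally show ?thesis using n by (simp add: field_simps)
      qed
      finally have "a n / real n < L + r" using k by simp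
      moreover have "L \<le> a n / real n" using n by (intro lower) simp
      ultimately show "norm (a n / real n - L) < r" by (simp add: abs_if)
    qed
  qed
  with lower show ?thesis by blast
qed

section \<open>Words over a finite alphabet and stationary weights on them\<close>

definition words :: "'a set \<Rightarrow> nat \<Rightarrow> 'a list set" where
  "words A n = {w. set w \<subseteq> A \<and> length w = n}"

lemma finite_words: "finite A \<Longrightarrow> finite (words A n)"
  unfolding words_def by (rule finite_lists_length_eq)

lemma words_0 [simp]: "words A 0 = {[]}"
  by (auto simp: words_def)

lemma sum_words_append:
  "(\<Sum>w\<in>words A (m + n). f w) = (\<Sum>u\<in>words A m. \<Sum>v\<in>words A n. f (u @ v))"
proof -
  have "(\<Sum>u\<in>words A m. \<Sum>v\<in>words A n. f (u @ v)) = (\<Sum>z\<in>words A m \<times> words A n. f (fst z @ snd z))"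
    by (simp add: sum.cartesian_product split_beta)
  also have "\<dots> = (\<Sum>w\<in>words A (m + n). f w)"
    by (rule sum.reindex_bij_witness[where j = "\<lambda>z. fst z @ snd z" and i = "\<lambda>w. (take m w, drop m w)"])
      (auto simp: words_def dest: in_set_takeD in_set_dropD)
  finally show ?thesis by simp
qed

lemma sum_words_1: "(\<Sum>w\<in>words A (Suc 0). f w) = (\<Sum>a\<in>A. f [a])"
  by (rule sum.reindex_bij_witness[where i = "\<lambda>a. [a]" and j = hd])
    (auto simp: words_def length_Suc_conv)

lemma sum_words_Suc: "(\<Sum>w\<in>words A (Suc n). f w) = (\<Sum>a\<in>A. \<Sum>w\<in>words A n. f (a # w))"
  using sum_words_append[of f A "Suc 0" n] by (simp add: sum_words_1)

lemma sum_words_Suc': "(\<Sum>w\<in>words A (Suc n). f w) = (\<Sum>w\<in>words A n. \<Sum>a\<in>A. f (w @ [a]))"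
  using sum_words_append[of f A n "Suc 0"] by (simp add: sum_words_1)

definition block_entropy :: "'a set \<Rightarrow> ('a list \<Rightarrow> real) \<Rightarrow> nat \<Rightarrow> real" where
  "block_entropy A p n = (\<Sum>w\<in>words A n. eta (p w))"

text \<open>These are the axioms of the cylinder probabilities of a stationary process:
  \<open>extend_right\<close> is consistency, \<open>extend_left\<close> is shift
  invariance.\<close>

locale stationary_weights =
  fixes A :: "'a set" and p :: "'a list \<Rightarrow> real"
  assumes fin: "finite A"
    and nonneg: "\<And>w. 0 \<le> p w"
    and total: "p [] = 1"
    and extend_right: "\<And>w. set w \<subseteq> A \<Longrightarrow> (\<Sum>a\<in>A. p (w @ [a])) = p w"
    and extend_left: "\<And>w. set w \<subseteq> A \<Longrightarrow> (\<Sum>a\<in>A. p (a # w)) = p w"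
begin

lemma sum_right: "set w \<subseteq> A \<Longrightarrow> (\<Sum>v\<in>words A n. p (w @ v)) = p w"
proof (induction n)
  case (Suc n)
  have "(\<Sum>v\<in>words A (Suc n). p (w @ v)) = (\<Sum>v\<in>words A n. \<Sum>a\<in>A. p ((w @ v) @ [a]))"
    by (simp add: sum_words_Suc')
  also have "\<dots> = (\<Sum>v\<in>words A n. p (w @ v))"
    using Suc.prems by (intro sum.cong refl extend_right) (auto simp: words_def)
  finally show ?case using Suc by simp
qed simp

lemma sum_left: "set w \<subseteq> A \<Longrightarrow> (\<Sum>v\<in>words A n. p (v @ w)) = p w"
proof (induction n)
  case (Suc n)
  have "(\<Sum>v\<in>words A (Suc n). p (v @ w)) = (\<Sum>v\<in>words A n. \<Sum>a\<in>A. p (a # (v @ w)))"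
    by (subst sum.swap) (simp add: sum_words_Suc)
  also have "\<dots> = (\<Sum>v\<in>words A n. p (v @ w))"
    using Suc.prems by (intro sum.cong refl extend_left) (auto simp: words_def)
  finally show ?case using Suc by simp
qed simp

lemma sum_words: "(\<Sum>v\<in>words A n. p v) = 1"
  using sum_right[of "[]" n] total by simp

lemma le_1: "w \<in> words A n \<Longrightarrow> p w \<le> 1"
  using member_le_sum[of w "words A n" p] sum_words[of n] nonneg finite_words[OF fin] by auto

lemma block_entropy_nonneg: "0 \<le> block_entropy A p n"
  unfolding block_entropy_def by (intro sum_nonneg eta_nonneg nonneg) (rule le_1)

text \<open>A word of length \<open>m + n\<close> is a pair of adjacent blocks. Consistency gives
  the marginal of the first block, stationarity that of the second.\<close>

lemma block_entropy_add: "block_entropy A p (m + n) \<le> block_entropy A p m + block_entropy A p n"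
proof -
  have "block_entropy A p (m + n) = (\<Sum>u\<in>words A m. \<Sum>v\<in>words A n. eta (p (u @ v)))"
    by (simp add: block_entropy_def sum_words_append)
  also have "\<dots> \<le> (\<Sum>u\<in>words A m. eta (\<Sum>v\<in>words A n. p (u @ v))) +
                  (\<Sum>v\<in>words A n. eta (\<Sum>u\<in>words A m. p (u @ v)))"
    by (intro joint_eta_le finite_words fin nonneg)
      (simp add: sum_words flip: sum_words_append)
  also have "\<dots> = block_entropy A p m + block_entropy A p n"
    unfolding block_entropy_def
    by (intro arg_cong2[where f = "(+)"] sum.cong refl arg_cong[where f = eta] sum_right sum_left)
      (auto simp: words_def)
  finally show ?thesis .
qed

lemma block_entropy_limit:
  "\<exists>L. (\<lambda>n. block_entropy A p n / real n) \<longlonglongrightarrow> L \<and> (\<forall>n\<ge>1. L \<le> block_entropy A p n / real n)"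
  by (intro subadditive_limit block_entropy_nonneg block_entropy_add)

end

section \<open>Birkhoff's ergodic theorem\<close>

definition rlimsup :: "(nat \<Rightarrow> real) \<Rightarrow> real" where
  "rlimsup u = real_of_ereal (limsup (\<lambda>n. ereal (u n)))"

text \<open>The eventual bounds exclude an infinite limsup, which \<open>real_of_ereal\<close> would
  turn into 0. For the same reason \<open>rlimsup_le\<close> also asks for a lower bound and
  \<open>rlimsup_ge\<close> for an upper one.\<close>

lemma ereal_rlimsup:
  assumes "eventually (\<lambda>n. a \<le> u n \<and> u n \<le> b) sequentially"
  shows "ereal (rlimsup u) = limsup (\<lambda>n. ereal (u n))"
proof -
  have "limsup (\<lambda>n. ereal (u n)) \<le> ereal b"
    using assms by (intro Limsup_bounded) (auto elim: eventually_mono)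
  moreover have "ereal a \<le> liminf (\<lambda>n. ereal (u n))"
    using assms by (intro Liminf_bounded) (auto elim: eventually_mono)
  then have "ereal a \<le> limsup (\<lambda>n. ereal (u n))"
    using Liminf_le_Limsup[of sequentially "\<lambda>n. ereal (u n)"] by (auto intro: order_trans)
  ultimately show ?thesis
    unfolding rlimsup_def by (intro ereal_real') (cases "limsup (\<lambda>n. ereal (u n))", auto)
qed

lemma rlimsup_less_eventually:
  assumes "eventually (\<lambda>n. a \<le> u n \<and> u n \<le> b) sequentially" "rlimsup u < c"
  shows "eventually (\<lambda>n. u n < c) sequentially"
proof -
  have "limsup (\<lambda>n. ereal (u n)) < ereal c"
    using assms by (simp flip: ereal_rlimsup)
  from Limsup_lessD[OF this] show ?thesis by simp
qed

lemma rlimsup_le: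
  assumes "eventually (\<lambda>n. a \<le> u n) sequentially" "eventually (\<lambda>n. u n \<le> c) sequentially"
  shows "rlimsup u \<le> c"
proof -
  have "eventually (\<lambda>n. a \<le> u n \<and> u n \<le> c) sequentially"
    using assms by eventually_elim auto
  from ereal_rlimsup[OF this] have "ereal (rlimsup u) = limsup (\<lambda>n. ereal (u n))" .
  also have "\<dots> \<le> ereal c"
    using assms(2) by (intro Limsup_bounded) (auto elim: eventually_mono)
  finally show ?thesis by simp
qed

lemma rlimsup_ge:
  assumes "eventually (\<lambda>n. a \<le> u n) sequentially" "eventually (\<lambda>n. u n \<le> c) sequentially"
  shows "a \<le> rlimsup u"
proof (rule ccontr)
  assume "\<not> ?thesis"
  moreover have ev: "eventually (\<lambda>n. a \<le> u n \<and> u n \<le> c) sequentially"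
    using assms by eventually_elim auto
  ultimately have "eventually (\<lambda>n. u n < a) sequentially"
    using rlimsup_less_eventually[of a u c a] by auto
  then have "eventually (\<lambda>n::nat. False) sequentially"
    using assms(1) by eventually_elim auto
  then show False by simp
qed

text \<open>Absorbs vanishing errors: boundary terms of orbit averages, the o(n) term of an optimal
  code, the additive constant of a universal machine. The upper bound on \<open>u\<close> is
  inherited from \<open>v\<close>.\<close>

lemma rlimsup_le_add:
  assumes "eventually (\<lambda>n. a \<le> u n) sequentially"
    and v: "eventually (\<lambda>n. a \<le> v n \<and> v n \<le> b) sequentially"
    and w: "w \<longlonglongrightarrow> 0"
    and "eventually (\<lambda>n. u n \<le> v n + w n) sequentially"
  shows "rlimsup u \<le> rlimsup v"
proof (rule field_le_epsilon)
  fix e :: real assume e: "0 < e"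
  have "eventually (\<lambda>n. v n < rlimsup v + e/2) sequentially"
    using e by (intro rlimsup_less_eventually[OF v]) auto
  moreover have "eventually (\<lambda>n. w n < e/2) sequentially"
    using w e by (intro order_tendstoD) auto
  ultimately have "eventually (\<lambda>n. u n \<le> rlimsup v + e) sequentially"
    using assms(4) by eventually_elim auto
  then show "rlimsup u \<le> rlimsup v + e"
    by (rule rlimsup_le[OF assms(1)])
qed

lemma rlimsup_eq_lim: "u \<longlonglongrightarrow> L \<Longrightarrow> rlimsup u = L"
  unfolding rlimsup_def using lim_imp_Limsup[OF sequentially_bot, of "\<lambda>n. ereal (u n)" "ereal L"]
  by (simp add: tendsto_ereal)

lemma borel_measurable_rlimsup [measurable]:
  assumes [measurable]: "\<And>n. u n \<in> borel_measurable M"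
  shows "(\<lambda>x. rlimsup (\<lambda>n. u n x)) \<in> borel_measurable M"
  unfolding rlimsup_def by measurable

section \<open>Measure-preserving maps and orbit averages\<close>

locale measure_preserving = prob_space M for M :: "'b measure" +
  fixes T :: "'b \<Rightarrow> 'b"
  assumes T_measurable [measurable]: "T \<in> measurable M M"
    and T_distr: "distr M M T = M"
begin

lemma T_space: "x \<in> space M \<Longrightarrow> T x \<in> space M"
  using T_measurable by (rule measurable_space)

lemma integral_T:
  fixes f :: "'b \<Rightarrow> real"
  assumes "f \<in> borel_measurable M"
  shows "(\<integral>x. f (T x) \<partial>M) = (\<integral>x. f x \<partial>M)"
  using integral_distr[OF T_measurable, of f] assms by (simp add: T_distr)

lemma funpow_measurable [measurable]: "(T ^^ n) \<in> measurable M M"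
  by (induction n) (auto intro: measurable_comp[OF _ T_measurable] simp: id_def)

lemma distr_funpow: "distr M M (T ^^ n) = M"
proof (induction n)
  case (Suc n)
  have "distr M M (T ^^ Suc n) = distr (distr M M (T ^^ n)) M T"
    by (subst distr_distr) auto
  then show ?case unfolding Suc T_distr .
qed (simp add: id_def distr_id)

lemma bounded_integrable:
  fixes f :: "'b \<Rightarrow> real"
  assumes "f \<in> borel_measurable M" "\<And>x. x \<in> space M \<Longrightarrow> \<bar>f x\<bar> \<le> B"
  shows "integrable M f"
  by (rule integrable_const_bound[of _ B]) (use assms in auto)

definition birkhoff_sum :: "('b \<Rightarrow> real) \<Rightarrow> nat \<Rightarrow> 'b \<Rightarrow> real" where
  "birkhoff_sum f n x = (\<Sum>i<n. f ((T ^^ i) x))"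

lemma birkhoff_sum_measurable [measurable]:
  assumes [measurable]: "f \<in> borel_measurable M"
  shows "birkhoff_sum f n \<in> borel_measurable M"
  unfolding birkhoff_sum_def by measurable

lemma birkhoff_sum_Suc: "birkhoff_sum f (Suc n) x = f x + birkhoff_sum f n (T x)"
  unfolding birkhoff_sum_def by (subst sum.lessThan_Suc_shift) (simp add: funpow_swap1)

text \<open>This is the maximum of the orbit sums of lengths 0 to N, in the recursive form on which
  Garsia's proof of the maximal inequality rests.\<close>

primrec max_sum :: "('b \<Rightarrow> real) \<Rightarrow> nat \<Rightarrow> 'b \<Rightarrow> real" where
  "max_sum g 0 x = 0"
| "max_sum g (Suc N) x = max 0 (g x + max_sum g N (T x))"

lemma max_sum_measurable [measurable]:
  assumes [measurable]: "g \<in> borel_measurable M"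
  shows "max_sum g N \<in> borel_measurable M"
proof (induction N)
  case (Suc N)
  note [measurable] = Suc
  have "(\<lambda>x. max 0 (g x + max_sum g N (T x))) \<in> borel_measurable M" by measurable
  then show ?case by (simp cong: measurable_cong)
qed (simp cong: measurable_cong)

lemma max_sum_nonneg: "0 \<le> max_sum g N x"
  by (cases N) auto

lemma max_sum_Suc_mono: "max_sum g N x \<le> max_sum g (Suc N) x"
proof (induction N arbitrary: x)
  case (Suc N)
  from Suc[of "T x"] show ?case by simp
qed simp

lemma max_sum_mono: "m \<le> n \<Longrightarrow> max_sum g m x \<le> max_sum g n x"
  by (rule lift_Suc_mono_le[of "\<lambda>n. max_sum g n x"]) (rule max_sum_Suc_mono)

lemma max_sum_le:
  assumes "\<And>x. x \<in> space M \<Longrightarrow> \<bar>g x\<bar> \<le> B" "x \<in> space M"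
  shows "max_sum g N x \<le> real N * B"
  using assms(2)
proof (induction N arbitrary: x)
  case (Suc N)
  have "0 \<le> B" using assms(1)[OF Suc.prems] by linarith
  then show ?case
    using assms(1)[OF Suc.prems] Suc.IH[OF T_space[OF Suc.prems]] by (auto simp: algebra_simps max_def)
qed simp

lemma birkhoff_sum_le_max_sum: "birkhoff_sum g N x \<le> max_sum g N x"
proof (induction N arbitrary: x)
  case 0
  then show ?case by (simp add: birkhoff_sum_def)
next
  case (Suc N)
  from Suc[of "T x"] show ?case by (simp add: birkhoff_sum_Suc)
qed

text \<open>Garsia's argument. Where \<open>max_sum g N\<close> is positive it is at most
  \<open>g\<close> plus its own value at \<open>T x\<close>, by the recursion and monotonicity in
  \<open>N\<close>; elsewhere it is 0 and its value at \<open>T x\<close> is nonnegative.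
  Integrating, the two \<open>max_sum\<close> terms cancel by invariance.\<close>

lemma maximal_ergodic:
  assumes g [measurable]: "g \<in> borel_measurable M"
    and B: "\<And>x. x \<in> space M \<Longrightarrow> \<bar>g x\<bar> \<le> B"
  shows "0 \<le> (\<integral>x. indicator {x \<in> space M. 0 < max_sum g N x} x * g x \<partial>M)"
proof -
  have int: "integrable M (max_sum g N)"
    by (rule bounded_integrable[of _ "real N * B"])
      (use max_sum_le[OF B] max_sum_nonneg in auto)
  have intT: "integrable M (\<lambda>x. max_sum g N (T x))"
    by (rule bounded_integrable[of _ "real N * B"])
      (use max_sum_le[OF B] max_sum_nonneg T_space in auto)
  have "0 = (\<integral>x. max_sum g N x - max_sum g N (T x) \<partial>M)"
    using int intT by (simp add: integral_T)
  also have "\<dots> \<le> (\<integral>x. indicator {x \<in> space M. 0 < max_sum g N x} x * g x \<partial>M)"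
  proof (rule integral_mono)
    show "integrable M (\<lambda>x. max_sum g N x - max_sum g N (T x))" using int intT by simp
    show "integrable M (\<lambda>x. indicator {x \<in> space M. 0 < max_sum g N x} x * g x)"
      by (rule bounded_integrable[of _ B]) (use B in \<open>auto simp: indicator_def, fastforce+\<close>)
    fix x assume x: "x \<in> space M"
    show "max_sum g N x - max_sum g N (T x) \<le> indicator {x \<in> space M. 0 < max_sum g N x} x * g x"
    proof (cases "0 < max_sum g N x")
      case True
      then obtain N' where N: "N = Suc N'" by (cases N) auto
      with True have "max_sum g N x = g x + max_sum g N' (T x)" by (auto simp: max_def split: if_splits)
      also have "\<dots> \<le> g x + max_sum g N (T x)" using max_sum_Suc_mono N by auto
      finally show ?thesis using True x by simp
    next
      case False
      then show ?thesis using max_sum_nonneg[of g N x] max_sum_nonneg[of g N "T x"] by simp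
    qed
  qed
  finally show ?thesis .
qed

text \<open>The sets on which \<open>max_sum g N\<close> is positive grow to the whole space, so the
  maximal inequality passes to the limit by dominated convergence.\<close>

lemma integral_nonneg_if_positive_sums:
  assumes g [measurable]: "g \<in> borel_measurable M"
    and B: "\<And>x. x \<in> space M \<Longrightarrow> \<bar>g x\<bar> \<le> B"
    and pos: "\<And>x. x \<in> space M \<Longrightarrow> \<exists>n. 0 < birkhoff_sum g n x"
  shows "0 \<le> (\<integral>x. g x \<partial>M)"
proof -
  have "(\<lambda>N. \<integral>x. indicator {x \<in> space M. 0 < max_sum g N x} x * g x \<partial>M) \<longlonglongrightarrow> (\<integral>x. g x \<partial>M)"
  proof (rule integral_dominated_convergence[where w = "\<lambda>_. B"])
    show "AE x in M. (\<lambda>N. indicator {x \<in> space M. 0 < max_sum g N x} x * g x) \<longlonglongrightarrow> g x"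
    proof (rule AE_I2)
      fix x assume x: "x \<in> space M"
      then obtain n where n: "0 < birkhoff_sum g n x" using pos by blast
      have "0 < max_sum g N x" if "N \<ge> n" for N
        using n birkhoff_sum_le_max_sum[of g n x] max_sum_mono[OF that, of g x] by linarith
      then have "eventually (\<lambda>N. indicator {x \<in> space M. 0 < max_sum g N x} x * g x = g x) sequentially"
        using x by (intro eventually_sequentiallyI[of n]) auto
      then show "(\<lambda>N. indicator {x \<in> space M. 0 < max_sum g N x} x * g x) \<longlonglongrightarrow> g x"
        by (rule tendsto_eventually)
    qed
    show "AE x in M. norm (indicator {x \<in> space M. 0 < max_sum g N x} x * g x) \<le> B" for N
      using B by (intro AE_I2) (auto simp: indicator_def, fastforce+)
  qed auto
  then show ?thesis
    by (rule LIMSEQ_le_const) (use maximal_ergodic[OF g B] in auto)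
qed

lemma birkhoff_sum_bounds:
  assumes "\<And>x. x \<in> space M \<Longrightarrow> 0 \<le> f x \<and> f x \<le> 1" "x \<in> space M"
  shows "0 \<le> birkhoff_sum f n x / real n \<and> birkhoff_sum f n x / real n \<le> 1"
proof -
  have "(T ^^ i) x \<in> space M" for i using funpow_measurable assms(2) by (rule measurable_space)
  then have "0 \<le> f ((T ^^ i) x) \<and> f ((T ^^ i) x) \<le> 1" for i using assms(1) by auto
  then have "0 \<le> birkhoff_sum f n x" "birkhoff_sum f n x \<le> real n"
    using sum_bounded_above[of "{..<n}" "\<lambda>i. f ((T ^^ i) x)" 1]
    by (auto simp: birkhoff_sum_def intro!: sum_nonneg)
  then show ?thesis by (auto simp: divide_le_eq)
qed

definition upper_average :: "('b \<Rightarrow> real) \<Rightarrow> 'b \<Rightarrow> real" where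
  "upper_average f x = rlimsup (\<lambda>n. birkhoff_sum f n x / real n)"

lemma upper_average_measurable [measurable]:
  assumes [measurable]: "f \<in> borel_measurable M"
  shows "upper_average f \<in> borel_measurable M"
  unfolding upper_average_def[abs_def] by measurable

lemma
  assumes "\<And>x. x \<in> space M \<Longrightarrow> 0 \<le> f x \<and> f x \<le> 1" "x \<in> space M"
  shows upper_average_nonneg: "0 \<le> upper_average f x"
    and upper_average_le_1: "upper_average f x \<le> 1"
  unfolding upper_average_def using birkhoff_sum_bounds[OF assms]
  by (auto intro!: rlimsup_ge[where c = 1] rlimsup_le[where a = 0])

text \<open>The two sums differ only in their end terms \<open>f x\<close> and
  \<open>f ((T ^^ n) x)\<close>.\<close>

lemma birkhoff_average_T_diff:
  assumes f: "\<And>x. x \<in> space M \<Longrightarrow> 0 \<le> f x \<and> f x \<le> 1" and x: "x \<in> space M"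
  shows "\<bar>birkhoff_sum f n (T x) / real n - birkhoff_sum f n x / real n\<bar> \<le> 1 / real n"
proof -
  have "birkhoff_sum f n x + f ((T ^^ n) x) = f x + birkhoff_sum f n (T x)"
    using birkhoff_sum_Suc[of f n x] by (simp add: birkhoff_sum_def)
  moreover have "(T ^^ n) x \<in> space M" using funpow_measurable x by (rule measurable_space)
  ultimately have "\<bar>birkhoff_sum f n (T x) - birkhoff_sum f n x\<bar> \<le> 1"
    using f[OF x] f[of "(T ^^ n) x"] by auto
  then show ?thesis by (simp add: divide_right_mono flip: diff_divide_distrib)
qed

lemma upper_average_T:
  assumes f: "\<And>x. x \<in> space M \<Longrightarrow> 0 \<le> f x \<and> f x \<le> 1" and x: "x \<in> space M"
  shows "upper_average f (T x) = upper_average f x"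
proof -
  have diff: "birkhoff_sum f n (T x) / real n \<le> birkhoff_sum f n x / real n + 1 / real n"
      "birkhoff_sum f n x / real n \<le> birkhoff_sum f n (T x) / real n + 1 / real n" for n
    using birkhoff_average_T_diff[where f = f and n = n, OF f x] by (simp_all add: abs_le_iff)
  have w: "(\<lambda>n. 1 / real n) \<longlonglongrightarrow> 0" by real_asymp
  have bounds: "0 \<le> birkhoff_sum f n y / real n \<and> birkhoff_sum f n y / real n \<le> 1" if "y \<in> space M" for n y
    using f that by (rule birkhoff_sum_bounds)
  show ?thesis
    unfolding upper_average_def
    by (intro antisym rlimsup_le_add[where a = 0 and b = 1, OF _ _ w] always_eventually allI)
      (use diff bounds[OF x] bounds[OF T_space[OF x]] in auto)
qed

text \<open>Let F be the upper average. The function \<open>f - (F - e)\<close> has a positive orbit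
  sum at every point: F is invariant, so the sum of length n is that of \<open>f\<close> minus
  \<open>n * (F - e)\<close>, and the averages of \<open>f\<close> exceed \<open>F - e\<close> for
  some n by definition of the limsup.\<close>

lemma integral_upper_average_le:
  assumes [measurable]: "f \<in> borel_measurable M"
    and f: "\<And>x. x \<in> space M \<Longrightarrow> 0 \<le> f x \<and> f x \<le> 1"
  shows "(\<integral>x. upper_average f x \<partial>M) \<le> (\<integral>x. f x \<partial>M)"
proof (rule field_le_epsilon)
  fix e :: real assume e: "0 < e"
  define F where "F = upper_average f"
  have [measurable]: "F \<in> borel_measurable M" unfolding F_def by measurable
  have F: "0 \<le> F x \<and> F x \<le> 1" if "x \<in> space M" for x
    unfolding F_def using upper_average_nonneg[OF f] upper_average_le_1[OF f] that by auto
  have FT: "F ((T ^^ i) x) = F x" if "x \<in> space M" for i x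
    using that
  proof (induction i)
    case (Suc i)
    have "(T ^^ i) x \<in> space M" using funpow_measurable Suc(2) by (rule measurable_space)
    then show ?case using Suc upper_average_T[OF f] by (simp add: F_def)
  qed simp
  have "0 \<le> (\<integral>x. f x - (F x - e) \<partial>M)"
  proof (rule integral_nonneg_if_positive_sums[where B = "2 + e"])
    show "\<bar>f x - (F x - e)\<bar> \<le> 2 + e" if "x \<in> space M" for x
      using f[OF that] F[OF that] e by auto
    fix x assume x: "x \<in> space M"
    have "\<exists>n\<ge>1. F x - e < birkhoff_sum f n x / real n"
    proof (rule ccontr)
      assume "\<not> ?thesis"
      then have "eventually (\<lambda>n. birkhoff_sum f n x / real n \<le> F x - e) sequentially"
        by (intro eventually_sequentiallyI[of 1]) (auto simp: not_less)
      then have "F x \<le> F x - e"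
        unfolding F_def upper_average_def
        by (intro rlimsup_le[where a = 0]) (use birkhoff_sum_bounds[OF f x] in auto)
      with e show False by simp
    qed
    then obtain n where n: "n \<ge> 1" "F x - e < birkhoff_sum f n x / real n" by blast
    have "birkhoff_sum (\<lambda>x. f x - (F x - e)) n x = birkhoff_sum f n x - real n * (F x - e)"
      unfolding birkhoff_sum_def by (simp add: sum_subtractf FT[OF x])
    also have "\<dots> > 0" using n by (simp add: field_simps)
    finally show "\<exists>n. 0 < birkhoff_sum (\<lambda>x. f x - (F x - e)) n x" by blast
  qed auto
  also have "(\<integral>x. f x - (F x - e) \<partial>M) = (\<integral>x. f x \<partial>M) - ((\<integral>x. F x \<partial>M) - e)"
  proof -
    have "integrable M f" "integrable M F"
      by (rule bounded_integrable[of _ 1], use f F in auto)+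
    then show ?thesis by (simp add: prob_space)
  qed
  finally show "(\<integral>x. upper_average f x \<partial>M) \<le> (\<integral>x. f x \<partial>M) + e" by (simp add: F_def)
qed

text \<open>The integral bound is applied to \<open>f\<close> and to \<open>1 - f\<close>. Their
  upper averages F and F' satisfy F + F' \<ge> 1, because 1 - F' is the lower average of
  \<open>f\<close>; their integrals add up to at most 1. Hence F + F' = 1 almost everywhere, that
  is, upper and lower averages agree, and both integral bounds are equalities.\<close>

theorem birkhoff:
  assumes [measurable]: "f \<in> borel_measurable M"
    and f: "\<And>x. x \<in> space M \<Longrightarrow> 0 \<le> f x \<and> f x \<le> 1"
  shows "AE x in M. (\<lambda>n. birkhoff_sum f n x / real n) \<longlonglongrightarrow> upper_average f x"
    and "(\<integral>x. upper_average f x \<partial>M) = (\<integral>x. f x \<partial>M)"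
proof -
  define f' where "f' x = 1 - f x" for x
  have [measurable]: "f' \<in> borel_measurable M" unfolding f'_def by measurable
  have f': "0 \<le> f' x \<and> f' x \<le> 1" if "x \<in> space M" for x using f[OF that] by (auto simp: f'_def)
  define F where "F = upper_average f"
  define F' where "F' = upper_average f'"
  have [measurable]: "F \<in> borel_measurable M" "F' \<in> borel_measurable M"
    unfolding F_def F'_def by measurable
  have F: "0 \<le> F x \<and> F x \<le> 1" "0 \<le> F' x \<and> F' x \<le> 1" if "x \<in> space M" for x
    unfolding F_def F'_def using upper_average_nonneg[OF f] upper_average_le_1[OF f]
      upper_average_nonneg[OF f'] upper_average_le_1[OF f'] that by auto
  have int: "integrable M f" "integrable M F" "integrable M F'"
    by (rule bounded_integrable[of _ 1], use f F in auto)+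
  have sums: "birkhoff_sum f' n x / real n = 1 - birkhoff_sum f n x / real n" if "n \<ge> 1" for n x
    using that by (simp add: birkhoff_sum_def f'_def sum_subtractf field_simps)
  have near: "eventually (\<lambda>n. birkhoff_sum f n x / real n < F x + e \<and>
      1 - F' x - e < birkhoff_sum f n x / real n) sequentially"
    if x: "x \<in> space M" and e: "0 < e" for x e
  proof -
    have "eventually (\<lambda>n. birkhoff_sum f n x / real n < F x + e) sequentially"
      by (rule rlimsup_less_eventually[where a = 0 and b = 1])
        (use birkhoff_sum_bounds[OF f x] e in \<open>auto simp: F_def upper_average_def\<close>)
    moreover have "eventually (\<lambda>n. birkhoff_sum f' n x / real n < F' x + e) sequentially"
      by (rule rlimsup_less_eventually[where a = 0 and b = 1])
        (use birkhoff_sum_bounds[OF f' x] e in \<open>auto simp: F'_def upper_average_def\<close>)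
    ultimately show ?thesis
      using eventually_ge_at_top[of 1] by eventually_elim (auto simp: sums)
  qed
  have ge: "1 \<le> F x + F' x" if x: "x \<in> space M" for x
  proof (rule ccontr)
    assume "\<not> ?thesis"
    then have "eventually (\<lambda>n::nat. False) sequentially"
      \<comment> \<open>With half the gap as error, the strict upper and lower bounds in
        \<open>near\<close> become the same number.\<close>
      using near[OF x, of "(1 - (F x + F' x)) / 2"] by (elim eventually_mono[OF meta_mp]) argo+
    then show False by simp
  qed
  have le: "(\<integral>x. F x \<partial>M) \<le> (\<integral>x. f x \<partial>M)" "(\<integral>x. F' x \<partial>M) \<le> 1 - (\<integral>x. f x \<partial>M)"
    using integral_upper_average_le[of f, OF _ f] integral_upper_average_le[of f', OF _ f'] int(1)
      Bochner_Integration.integral_diff[of M "\<lambda>_. 1" f]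
    by (simp_all add: F_def F'_def f'_def[abs_def] prob_space)
  have int0: "(\<integral>x. F x + F' x - 1 \<partial>M) = (\<integral>x. F x \<partial>M) + (\<integral>x. F' x \<partial>M) - 1"
    using int by (simp add: prob_space)
  have nn: "0 \<le> (\<integral>x. F x + F' x - 1 \<partial>M)"
    using ge by (intro integral_nonneg_AE AE_I2) auto
  with le int0 have eq: "(\<integral>x. F x + F' x - 1 \<partial>M) = 0" by linarith
  then have "AE x in M. F x + F' x - 1 = 0"
    using int ge by (subst (asm) integral_nonneg_eq_0_iff_AE) auto
  then show "AE x in M. (\<lambda>n. birkhoff_sum f n x / real n) \<longlonglongrightarrow> upper_average f x"
  proof (rule AE_mp, intro AE_I2 impI)
    fix x assume x: "x \<in> space M" "F x + F' x - 1 = 0"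
    show "(\<lambda>n. birkhoff_sum f n x / real n) \<longlonglongrightarrow> upper_average f x"
    proof (rule tendstoI)
      fix e :: real assume "0 < e"
      from near[OF x(1) this] x(2)
      show "eventually (\<lambda>n. dist (birkhoff_sum f n x / real n) (upper_average f x) < e) sequentially"
        by (auto elim!: eventually_mono simp: dist_real_def abs_less_iff F_def)
    qed
  qed
  show "(\<integral>x. upper_average f x \<partial>M) = (\<integral>x. f x \<partial>M)"
    using le nn int0 eq by (simp add: F_def)
qed

text \<open>A reverse Fatou lemma with a vanishing error. The \<open>u n\<close> need not converge,
  but the positive part of their excess over the limsup tends to 0 and stays between 0 and
  \<open>B\<close>.\<close>

lemma integral_rlimsup_ge:
  fixes u :: "nat \<Rightarrow> 'b \<Rightarrow> real"
  assumes [measurable]: "\<And>n. u n \<in> borel_measurable M"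
    and u: "\<And>n x. x \<in> space M \<Longrightarrow> 0 \<le> u n x \<and> u n x \<le> B"
    and w: "w \<longlonglongrightarrow> 0"
    and c: "eventually (\<lambda>n. c \<le> (\<integral>x. u n x \<partial>M) + w n) sequentially"
  shows "c \<le> (\<integral>x. rlimsup (\<lambda>n. u n x) \<partial>M)"
proof -
  define U where "U x = rlimsup (\<lambda>n. u n x)" for x
  have [measurable]: "U \<in> borel_measurable M" unfolding U_def by measurable
  have U: "0 \<le> U x \<and> U x \<le> B" if "x \<in> space M" for x
    unfolding U_def using u[OF that] by (auto intro!: rlimsup_ge[where c = B] rlimsup_le[where a = 0])
  have intU: "integrable M U" by (rule bounded_integrable[of _ B]) (use U in auto)
  have intu: "integrable M (u n)" for n by (rule bounded_integrable[of _ B]) (use u in auto)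
  have intm: "integrable M (\<lambda>x. max 0 (u n x - U x))" for n
    by (intro integrable_max Bochner_Integration.integrable_diff intU intu) auto
  have "(\<lambda>n. \<integral>x. max 0 (u n x - U x) \<partial>M) \<longlonglongrightarrow> (\<integral>x. 0 \<partial>M)"
  proof (rule integral_dominated_convergence[where w = "\<lambda>_. B"])
    show "AE x in M. (\<lambda>n. max 0 (u n x - U x)) \<longlonglongrightarrow> 0"
    proof (rule AE_I2, rule tendstoI)
      fix x e assume x: "x \<in> space M" and e: "(0::real) < e"
      have "eventually (\<lambda>n. u n x < U x + e) sequentially"
        by (rule rlimsup_less_eventually[where a = 0 and b = B]) (use u[OF x] e in \<open>auto simp: U_def\<close>)
      then show "eventually (\<lambda>n. dist (max 0 (u n x - U x)) 0 < e) sequentially"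
        by eventually_elim (use e in auto)
    qed
    show "AE x in M. norm (max 0 (u n x - U x)) \<le> B" for n
    proof (rule AE_I2)
      fix x assume "x \<in> space M"
      then show "norm (max 0 (u n x - U x)) \<le> B" using U[of x] u[of x n] by auto
    qed
  qed auto
  then have "(\<lambda>n. (\<integral>x. U x \<partial>M) + (\<integral>x. max 0 (u n x - U x) \<partial>M) + w n) \<longlonglongrightarrow> (\<integral>x. U x \<partial>M) + 0 + 0"
    using w by (intro tendsto_add tendsto_const) auto
  moreover have "eventually (\<lambda>n. c \<le> (\<integral>x. U x \<partial>M) + (\<integral>x. max 0 (u n x - U x) \<partial>M) + w n) sequentially"
    using c
  proof eventually_elim
    case (elim n)
    have "(\<integral>x. u n x \<partial>M) \<le> (\<integral>x. U x + max 0 (u n x - U x) \<partial>M)"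
      using intU intm intu by (intro integral_mono) auto
    also have "\<dots> = (\<integral>x. U x \<partial>M) + (\<integral>x. max 0 (u n x - U x) \<partial>M)"
      using intU intm by simp
    finally show ?case using elim by simp
  qed
  ultimately show ?thesis
    unfolding U_def by (auto dest: tendsto_lowerbound)
qed

end

section \<open>Entropy rates and partitions\<close>

text \<open>Base 2 makes the library's entropy agree with sums of \<open>eta\<close>.\<close>

sublocale measure_preserving \<subseteq> information_space M 2
  by unfold_locales simp

context information_space
begin

lemma entropy_pair_le:
  assumes "simple_function M X" "simple_function M Y"
  shows "\<H>(\<lambda>x. (X x, Y x)) \<le> \<H>(X) + \<H>(Y)"
  using entropy_chain_rule[OF assms] conditional_entropy_less_eq_entropy[OF assms(2,1)] by simp

end

context measure_preserving
begin

section \<open>Entropy of names along orbits\<close>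

abbreviation ent :: "('b \<Rightarrow> 'x) \<Rightarrow> real" where
  "ent X \<equiv> entropy 2 (count_space (X ` space M)) X"

text \<open>A value that is not taken contributes \<open>eta 0 = 0\<close>, so the sum may run over
  any finite set containing the range; variables with different ranges can then be compared over one
  index set.\<close>

lemma entropy_eta:
  assumes X: "simple_function M X" and S: "finite S" "X ` space M \<subseteq> S"
  shows "ent X = (\<Sum>s\<in>S. eta (prob (X -` {s} \<inter> space M)))"
proof -
  have "ent X = (\<Sum>s\<in>X ` space M. eta (prob (X -` {s} \<inter> space M)))"
    using entropy_simple_distributed[OF simple_distributedI[OF X measure_nonneg refl]]
    by (simp add: eta_def sum_negf)
  also have "\<dots> = (\<Sum>s\<in>S. eta (prob (X -` {s} \<inter> space M)))"
  proof (rule sum.mono_neutral_left[OF S], rule ballI)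
    fix s assume "s \<in> S - X ` space M"
    then have "X -` {s} \<inter> space M = {}" by auto
    then show "eta (prob (X -` {s} \<inter> space M)) = 0" by simp
  qed
  finally show ?thesis .
qed

lemma entropy_nonneg_simple: "simple_function M X \<Longrightarrow> 0 \<le> ent X"
  by (subst entropy_eta[OF _ _ order_refl])
    (auto simp: simple_function_def intro!: sum_nonneg eta_nonneg)

lemma simple_function_funpow: "simple_function M X \<Longrightarrow> simple_function M (\<lambda>x. X ((T ^^ n) x))"
  by (rule simple_function_comp[OF funpow_measurable, unfolded comp_def])

lemma entropy_funpow:
  assumes X: "simple_function M X"
  shows "ent (\<lambda>x. X ((T ^^ n) x)) = ent X"
proof -
  have fin: "finite (X ` space M)" using X by (rule simple_functionD)
  have sp: "(T ^^ n) x \<in> space M" if "x \<in> space M" for x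
    using funpow_measurable that by (rule measurable_space)
  have "prob ((\<lambda>x. X ((T ^^ n) x)) -` {s} \<inter> space M) = prob (X -` {s} \<inter> space M)" for s
  proof -
    have "prob (X -` {s} \<inter> space M) = measure (distr M M (T ^^ n)) (X -` {s} \<inter> space M)"
      by (simp add: distr_funpow)
    also have "\<dots> = prob ((T ^^ n) -` (X -` {s} \<inter> space M) \<inter> space M)"
      using X by (intro measure_distr) (auto dest: simple_functionD)
    also have "(T ^^ n) -` (X -` {s} \<inter> space M) \<inter> space M = (\<lambda>x. X ((T ^^ n) x)) -` {s} \<inter> space M"
      using sp by auto
    finally show ?thesis by simp
  qed
  moreover have sub: "(\<lambda>x. X ((T ^^ n) x)) ` space M \<subseteq> X ` space M"
    using sp by auto
  ultimately show ?thesis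
    using entropy_eta[OF simple_function_funpow[OF X] fin sub] entropy_eta[OF X fin order_refl] by simp
qed

text \<open>The name of length n of a point. Its nonempty level sets are the cells of the n-fold
  join of the partition induced by \<open>X\<close>.\<close>

definition itinerary :: "('b \<Rightarrow> 'x) \<Rightarrow> nat \<Rightarrow> 'b \<Rightarrow> 'x list" where
  "itinerary X n x = map (\<lambda>i. X ((T ^^ i) x)) [0..<n]"

lemma length_itinerary [simp]: "length (itinerary X n x) = n"
  by (simp add: itinerary_def)

lemma nth_itinerary [simp]: "i < n \<Longrightarrow> itinerary X n x ! i = X ((T ^^ i) x)"
  by (simp add: itinerary_def)

lemma itinerary_add: "itinerary X (m + n) x = itinerary X m x @ itinerary X n ((T ^^ m) x)"
proof (rule nth_equalityI)
  fix i assume i: "i < length (itinerary X (m + n) x)"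
  have "(T ^^ (i - m)) ((T ^^ m) x) = (T ^^ i) x" if "m \<le> i"
    using that by (metis comp_apply funpow_add le_add_diff_inverse2)
  with i show "itinerary X (m + n) x ! i = (itinerary X m x @ itinerary X n ((T ^^ m) x)) ! i"
    by (auto simp: nth_append)
qed simp

lemma simple_function_itinerary:
  assumes X: "simple_function M X"
  shows "simple_function M (itinerary X n)"
proof (induction n)
  case 0
  have "itinerary X 0 = (\<lambda>_. [])" by (simp add: itinerary_def fun_eq_iff)
  then show ?case by simp
next
  case (Suc n)
  have "itinerary X (Suc n) = (\<lambda>x. itinerary X n x @ [X ((T ^^ n) x)])"
    by (simp add: itinerary_def fun_eq_iff)
  then show ?case
    using simple_function_compose2[OF Suc simple_function_funpow[OF X], of "\<lambda>w a. w @ [a]" n] by simp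
qed

text \<open>A long name is a function of two consecutive shorter ones, and by invariance the second
  has the law of a name read from time 0.\<close>

lemma entropy_itinerary_add:
  assumes X: "simple_function M X"
  shows "ent (itinerary X (m + n)) \<le> ent (itinerary X m) + ent (itinerary X n)"
proof -
  note Xm = simple_function_itinerary[OF X, of m]
  note Xn = simple_function_funpow[OF simple_function_itinerary[OF X, of n], of m]
  have "itinerary X (m + n) = (\<lambda>(u, v). u @ v) \<circ> (\<lambda>x. (itinerary X m x, itinerary X n ((T ^^ m) x)))"
    by (simp add: fun_eq_iff itinerary_add)
  then have "ent (itinerary X (m + n)) \<le> ent (\<lambda>x. (itinerary X m x, itinerary X n ((T ^^ m) x)))"
    using entropy_data_processing[OF simple_function_Pair[OF Xm Xn], of "\<lambda>(u, v). u @ v"] by (simp add: comp_def)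
  also have "\<dots> \<le> ent (itinerary X m) + ent (\<lambda>x. itinerary X n ((T ^^ m) x))"
    by (rule entropy_pair_le[OF Xm Xn])
  finally show ?thesis
    by (simp add: entropy_funpow[OF simple_function_itinerary[OF X]])
qed

lemma entropy_itinerary_le:
  fixes X :: "'b \<Rightarrow> 'x"
  assumes X: "simple_function M X"
  shows "ent (itinerary X n) \<le> real n * ent X"
proof (induction n)
  case 0
  have "itinerary X 0 = (\<lambda>_. [])" by (simp add: itinerary_def fun_eq_iff)
  moreover have "ent (\<lambda>_. [] :: 'x list) = 0"
    by (subst entropy_eta[where S = "{[]}"]) (auto simp: prob_space)
  ultimately show ?case by simp
next
  case (Suc n)
  have "itinerary X 1 = (\<lambda>a. [a]) \<circ> X" by (auto simp: itinerary_def)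
  then have "ent (itinerary X 1) \<le> ent X"
    using entropy_data_processing[OF X] by metis
  then show ?case
    using entropy_itinerary_add[OF X, of n 1] Suc by (simp add: algebra_simps)
qed

definition entropy_rate :: "('b \<Rightarrow> 'x) \<Rightarrow> real" where
  "entropy_rate X = lim (\<lambda>n. ent (itinerary X n) / real n)"

lemma
  assumes X: "simple_function M X"
  shows entropy_rate_lim: "(\<lambda>n. ent (itinerary X n) / real n) \<longlonglongrightarrow> entropy_rate X"
    and entropy_rate_le: "n \<ge> 1 \<Longrightarrow> entropy_rate X \<le> ent (itinerary X n) / real n"
proof -
  obtain L where L: "(\<lambda>n. ent (itinerary X n) / real n) \<longlonglongrightarrow> L" "\<And>n. n \<ge> 1 \<Longrightarrow> L \<le> ent (itinerary X n) / real n"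
    using subadditive_limit[of "\<lambda>n. ent (itinerary X n)"] entropy_itinerary_add[OF X]
      entropy_nonneg_simple[OF simple_function_itinerary[OF X]] by blast
  from L(1) have "entropy_rate X = L" unfolding entropy_rate_def by (rule limI)
  with L show "(\<lambda>n. ent (itinerary X n) / real n) \<longlonglongrightarrow> entropy_rate X"
    "n \<ge> 1 \<Longrightarrow> entropy_rate X \<le> ent (itinerary X n) / real n" by auto
qed

text \<open>A variable that is almost always \<open>None\<close> has little entropy. The threshold
  \<open>e\<close> is fixed before \<open>Z\<close>, because \<open>Z\<close> will be built from an
  approximation whose accuracy depends on \<open>e\<close>.\<close>

lemma small_entropy:
  assumes "0 < d"
  shows "\<exists>e>0. \<forall>Z :: 'b \<Rightarrow> 'x option. simple_function M Z \<longrightarrow> Z ` space M \<subseteq> insert None (Some ` S) \<longrightarrow>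
    finite S \<longrightarrow> prob {x \<in> space M. Z x \<noteq> None} < e \<longrightarrow> ent Z \<le> d"
proof -
  define k where "k = real (card S) + 1"
  have k: "0 < k" by (simp add: k_def)
  have "((\<lambda>x. eta x) \<longlongrightarrow> 0) (at_right 0)"
    unfolding eta_def log_def by real_asymp
  then have "eventually (\<lambda>x. eta x < d / k) (at_right 0)"
    using assms k by (intro order_tendstoD) auto
  then obtain e1 where e1: "e1 > 0" "\<And>x. 0 < x \<Longrightarrow> x < e1 \<Longrightarrow> eta x < d / k"
    unfolding eventually_at_right_field by auto
  \<comment> \<open>There are at most \<open>k\<close> values. \<open>e1\<close> makes each rare
    value contribute at most \<open>d / k\<close>; the other bound does so for \<open>None\<close>,
    through the tangent of \<open>eta\<close> at 1.\<close>
  define e where "e = min e1 (d / k * ln 2)"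
  have "e > 0" using e1 assms k by (auto simp: e_def)
  moreover have "ent Z \<le> d"
    if Z: "simple_function M Z" and S: "Z ` space M \<subseteq> insert None (Some ` S)" "finite S"
      and pe: "prob {x \<in> space M. Z x \<noteq> None} < e" for Z :: "'b \<Rightarrow> 'x option"
  proof -
    have ms: "Z -` A \<inter> space M \<in> events" for A using Z by (rule simple_functionD)
    have "ent Z = (\<Sum>s\<in>insert None (Some ` S). eta (prob (Z -` {s} \<inter> space M)))"
      using S by (intro entropy_eta[OF Z]) auto
    also have "\<dots> \<le> (\<Sum>s\<in>insert None (Some ` S). d / k)"
    proof (rule sum_mono)
      fix s assume "s \<in> insert None (Some ` S)"
      show "eta (prob (Z -` {s} \<inter> space M)) \<le> d / k"
      proof (cases s)
        case None
        have "prob (Z -` {None} \<inter> space M) = 1 - prob {x \<in> space M. Z x \<noteq> None}"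
          by (subst prob_compl[symmetric]) (use ms[of "- {None}"] in
            \<open>auto simp: vimage_def Int_def conj_commute intro!: arg_cong[where f = prob]\<close>)
        then have "eta (prob (Z -` {None} \<inter> space M)) \<le> prob {x \<in> space M. Z x \<noteq> None} / ln 2"
          using eta_le_cross[of "prob (Z -` {None} \<inter> space M)" 1] by simp
        also have "\<dots> \<le> (d / k * ln 2) / ln 2"
          using pe by (intro divide_right_mono) (auto simp: e_def)
        finally show ?thesis using None by simp
      next
        case (Some v)
        have "prob (Z -` {s} \<inter> space M) \<le> prob (Z -` (- {None}) \<inter> space M)"
          using ms Some by (intro finite_measure_mono) auto
        also have "Z -` (- {None}) \<inter> space M = {x \<in> space M. Z x \<noteq> None}" by auto
        finally have *: "prob (Z -` {s} \<inter> space M) < e1" using pe by (simp add: e_def)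
        show ?thesis
        proof (cases "prob (Z -` {s} \<inter> space M) = 0")
          case False
          then have "0 < prob (Z -` {s} \<inter> space M)" using measure_nonneg by (metis less_eq_real_def)
          from e1(2)[OF this *] show ?thesis by simp
        qed (use assms k in simp)
      qed
    qed
    also have "\<dots> = real (card (insert None (Some ` S))) * (d / k)" by simp
    also have "\<dots> \<le> k * (d / k)"
      using S(2) assms k card_insert_le_m1[of "Suc (card S)" "Some ` S"]
      by (intro mult_right_mono) (auto simp: k_def card_image)
    finally show ?thesis using k by simp
  qed
  ultimately show ?thesis by blast
qed

text \<open>Guess \<open>V\<close> from a name of \<open>W\<close> and let \<open>Z\<close> record
  the true value when the guess fails. The n-name of \<open>V\<close> is a function of the
  (n+m)-name of \<open>W\<close> and the n-name of \<open>Z\<close>, so its entropy exceeds that of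
  the former by at most \<open>n * ent Z\<close>, where \<open>ent Z\<close> is small. Dividing by n
  gives the claim.\<close>

theorem entropy_rate_le_generator:
  fixes V :: "'b \<Rightarrow> 'v" and W :: "'b \<Rightarrow> 'w"
  assumes V: "simple_function M V" and W: "simple_function M W"
    and approx: "\<And>e. 0 < e \<Longrightarrow> \<exists>m g. prob {x \<in> space M. V x \<noteq> g (itinerary W m x)} < e"
  shows "entropy_rate V \<le> entropy_rate W"
proof (rule field_le_epsilon)
  fix d :: real assume "0 < d"
  from small_entropy[OF this, where S = "V ` space M"] obtain e where e: "e > 0" and
    small: "\<forall>Z :: 'b \<Rightarrow> 'v option. simple_function M Z \<longrightarrow>
      Z ` space M \<subseteq> insert None (Some ` V ` space M) \<longrightarrow> finite (V ` space M) \<longrightarrow>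
      prob {x \<in> space M. Z x \<noteq> None} < e \<longrightarrow> ent Z \<le> d"
    by (elim exE conjE)
  obtain m g where mg: "prob {x \<in> space M. V x \<noteq> g (itinerary W m x)} < e"
    using approx[OF e] by (elim exE)
  define Z where "Z x = (if V x = g (itinerary W m x) then None else Some (V x))" for x
  have Z: "simple_function M Z"
    unfolding Z_def using simple_function_compose2[OF V simple_function_itinerary[OF W, of m],
        of "\<lambda>v w. if v = g w then None else Some v"] .
  have "{x \<in> space M. Z x \<noteq> None} = {x \<in> space M. V x \<noteq> g (itinerary W m x)}"
    by (auto simp: Z_def)
  then have "ent Z \<le> d"
    using small[rule_format, OF Z _ simple_functionD(1)[OF V]] mg by (auto simp: Z_def)
  have bound: "ent (itinerary V n) \<le> ent (itinerary W (n + m)) + real n * d" for n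
  proof -
    \<comment> \<open>The decoder guesses from the window of length \<open>m\<close> at position
      \<open>i\<close> unless a correction is recorded. The \<open>m\<close> extra letters of
      \<open>w\<close> keep the last windows inside it.\<close>
    define F where "F = (\<lambda>(w, z). map (\<lambda>i. case z ! i of None \<Rightarrow> g (take m (drop i w)) | Some v \<Rightarrow> v) [0..<n])"
    have "itinerary V n x = F (itinerary W (n + m) x, itinerary Z n x)" for x
    proof (rule nth_equalityI)
      fix i assume "i < length (itinerary V n x)"
      then have i: "i < n" by simp
      have "itinerary W (n + m) x = itinerary W (i + (m + (n - i))) x"
        using i by (intro arg_cong[where f = "\<lambda>k. itinerary W k x"]) simp
      also have "\<dots> = itinerary W i x @ itinerary W m ((T ^^ i) x) @ itinerary W (n - i) ((T ^^ m) ((T ^^ i) x))"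
        by (simp only: itinerary_add)
      finally have "take m (drop i (itinerary W (n + m) x)) = itinerary W m ((T ^^ i) x)"
        by simp
      with i show "itinerary V n x ! i = F (itinerary W (n + m) x, itinerary Z n x) ! i"
        by (simp add: F_def Z_def)
    qed (simp add: F_def)
    then have eq: "itinerary V n = F \<circ> (\<lambda>x. (itinerary W (n + m) x, itinerary Z n x))"
      by (simp add: fun_eq_iff)
    have "ent (itinerary V n) \<le> ent (\<lambda>x. (itinerary W (n + m) x, itinerary Z n x))"
      unfolding eq by (intro entropy_data_processing simple_function_Pair simple_function_itinerary W Z)
    also have "\<dots> \<le> ent (itinerary W (n + m)) + ent (itinerary Z n)"
      by (intro entropy_pair_le simple_function_itinerary W Z)
    also have "ent (itinerary Z n) \<le> real n * ent Z" by (rule entropy_itinerary_le[OF Z])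
    also have "\<dots> \<le> real n * d" using \<open>ent Z \<le> d\<close> by (intro mult_left_mono) auto
    finally show ?thesis by simp
  qed
  have "(\<lambda>n. ent (itinerary W (n + m)) / real (n + m) * (real (n + m) / real n) + d) \<longlonglongrightarrow> entropy_rate W * 1 + d"
    by (intro tendsto_intros LIMSEQ_ignore_initial_segment[OF entropy_rate_lim[OF W]]) real_asymp
  then have "entropy_rate V \<le> entropy_rate W * 1 + d"
  proof (rule tendsto_le[OF sequentially_bot _ entropy_rate_lim[OF V]])
    show "eventually (\<lambda>n. ent (itinerary V n) / real n \<le>
        ent (itinerary W (n + m)) / real (n + m) * (real (n + m) / real n) + d) sequentially"
      using eventually_ge_at_top[of 1]
    proof eventually_elim
      case (elim n)
      have "ent (itinerary V n) / real n \<le> (ent (itinerary W (n + m)) + real n * d) / real n"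
        using bound by (intro divide_right_mono) auto
      with elim show ?case by (simp add: add_divide_distrib del: of_nat_add)
    qed
  qed
  then show "entropy_rate V \<le> entropy_rate W + d" by simp
qed

section \<open>Finite partitions as simple functions\<close>

definition cell_of :: "'b set set \<Rightarrow> 'b \<Rightarrow> 'b set" where
  "cell_of P x = (THE A. A \<in> P \<and> x \<in> A)"

context
  fixes P :: "'b set set"
  assumes P: "finite_meas_partition M P"
begin

lemma cell_of_eq: "A \<in> P \<Longrightarrow> x \<in> A \<Longrightarrow> cell_of P x = A"
  unfolding cell_of_def by (rule the_equality) (use P in \<open>unfold finite_meas_partition_def, blast+\<close>)

lemma cell_of_mem: "x \<in> space M \<Longrightarrow> cell_of P x \<in> P \<and> x \<in> cell_of P x"
  using P cell_of_eq unfolding finite_meas_partition_def by (metis UnionE)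

lemma cell_of_vimage: "A \<in> P \<Longrightarrow> cell_of P -` {A} \<inter> space M = A"
  using cell_of_mem cell_of_eq P unfolding finite_meas_partition_def by auto

lemma simple_function_cell_of: "simple_function M (cell_of P)"
proof -
  have sub: "cell_of P ` space M \<subseteq> P" using cell_of_mem by auto
  have P': "finite P" "P \<subseteq> sets M" using P by (auto simp: finite_meas_partition_def)
  show ?thesis
    unfolding simple_function_def
  proof (intro conjI ballI)
    show "finite (cell_of P ` space M)" using sub P'(1) by (rule finite_subset)
    fix A assume "A \<in> cell_of P ` space M"
    then have "A \<in> P" using sub by blast
    then show "cell_of P -` {A} \<inter> space M \<in> sets M" using cell_of_vimage P'(2) by auto
  qed
qed

text \<open>Choosing a cell for each time is prescribing a name; discarding empty intersections
  leaves exactly the names that occur. Hence the entropy of the join is that of the name.\<close>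

lemma iter_join_eq:
  "iter_join M T P n = (\<lambda>w. itinerary (cell_of P) n -` {w} \<inter> space M) ` itinerary (cell_of P) n ` space M"
proof -
  have sp: "(T ^^ i) x \<in> space M" if "x \<in> space M" for x i
    using funpow_measurable that by (rule measurable_space)
  have cell: "space M \<inter> (\<Inter>i\<in>{..<n}. (T ^^ i) -` f i) = itinerary (cell_of P) n -` {map f [0..<n]} \<inter> space M"
    if f: "\<forall>i<n. f i \<in> P" for f
  proof -
    have "(T ^^ i) x \<in> f i \<longleftrightarrow> cell_of P ((T ^^ i) x) = f i" if "x \<in> space M" "i < n" for x i
      using f that sp[of x i] cell_of_mem cell_of_eq by metis
    then show ?thesis by (auto simp: itinerary_def map_eq_conv)
  qed
  show ?thesis
  proof (intro equalityI subsetI)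
    fix A assume "A \<in> iter_join M T P n"
    then obtain f where f: "A \<noteq> {}" "\<forall>i<n. f i \<in> P" "A = space M \<inter> (\<Inter>i\<in>{..<n}. (T ^^ i) -` f i)"
      unfolding iter_join_def by blast
    with cell[OF f(2)] obtain x where "x \<in> space M" "itinerary (cell_of P) n x = map f [0..<n]"
      by auto
    with f cell[OF f(2)] have "A = itinerary (cell_of P) n -` {itinerary (cell_of P) n x} \<inter> space M"
      by simp
    then show "A \<in> (\<lambda>w. itinerary (cell_of P) n -` {w} \<inter> space M) ` itinerary (cell_of P) n ` space M"
      using \<open>x \<in> space M\<close> by (simp only:) (intro imageI)
  next
    fix A assume "A \<in> (\<lambda>w. itinerary (cell_of P) n -` {w} \<inter> space M) ` itinerary (cell_of P) n ` space M"
    then obtain x where x: "x \<in> space M" "A = itinerary (cell_of P) n -` {itinerary (cell_of P) n x} \<inter> space M"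
      by auto
    define f where "f i = cell_of P ((T ^^ i) x)" for i
    have f: "\<forall>i<n. f i \<in> P" using x sp cell_of_mem by (auto simp: f_def)
    have "itinerary (cell_of P) n x = map f [0..<n]" by (simp add: itinerary_def f_def)
    with cell[OF f] x have "A = space M \<inter> (\<Inter>i\<in>{..<n}. (T ^^ i) -` f i)" by simp
    moreover have "A \<noteq> {}" using x by auto
    ultimately show "A \<in> iter_join M T P n" unfolding iter_join_def using f by blast
  qed
qed

lemma partition_entropy_iter_join:
  "partition_entropy M (iter_join M T P n) = ent (itinerary (cell_of P) n)"
proof -
  let ?X = "itinerary (cell_of P) n"
  have inj: "inj_on (\<lambda>w. ?X -` {w} \<inter> space M) (?X ` space M)"
    by (rule inj_onI) blast
  have "ent (?X) = (\<Sum>s\<in>?X ` space M. eta (prob (?X -` {s} \<inter> space M)))"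
    using simple_function_itinerary[OF simple_function_cell_of]
    by (intro entropy_eta) (auto dest: simple_functionD(1))
  then show ?thesis
    unfolding partition_entropy_def iter_join_eq by (simp add: sum.reindex[OF inj] eta_def sum_negf)
qed

lemma entropy_wrt_partition_eq: "entropy_wrt_partition M T P = entropy_rate (cell_of P)"
  by (simp add: entropy_wrt_partition_def entropy_rate_def partition_entropy_iter_join)

end

end

section \<open>Partial recursive inverses\<close>

inductive_cases reval_RZ: "reval RZ xs y"
inductive_cases reval_RS: "reval RS xs y"
inductive_cases reval_RId: "reval (RId i) xs y"
inductive_cases reval_RCn: "reval (RCn f gs) xs y"
inductive_cases reval_RPr_0: "reval (RPr f g) (0 # xs) y"
inductive_cases reval_RPr_Suc: "reval (RPr f g) (Suc n # xs) y"
inductive_cases reval_RMn: "reval (RMn f) xs y"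

text \<open>\<open>partial_recursive_machine\<close> is an equivalence, so a program must be shown
  to have no output besides the intended one.\<close>

lemma reval_deterministic: "reval f xs y \<Longrightarrow> reval f xs z \<Longrightarrow> y = z"
proof (induction arbitrary: z rule: reval.induct)
  case (comp ys gs xs f r)
  from comp.prems obtain zs where zs: "length zs = length gs"
      "\<forall>i < length gs. reval (gs ! i) xs (zs ! i)" "reval f zs z"
    by (rule reval_RCn)
  have "ys = zs"
    using comp zs by (intro nth_equalityI) auto
  with zs comp.IH show ?case by blast
next
  case (pr0 f xs r g)
  from pr0.prems pr0.IH show ?case by (auto elim: reval_RPr_0)
next
  case (prS f g n xs r r')
  from prS.prems prS.IH show ?case by (auto elim: reval_RPr_Suc)
next
  case (mn f n xs)
  from mn.prems have z: "reval f (z # xs) 0" "\<forall>m<z. \<exists>k. reval f (m # xs) (Suc k)"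
    by (auto elim: reval_RMn)
  \<comment> \<open>The smaller of two different search results would make \<open>f\<close> yield
    both 0 and a successor.\<close>
  have "\<not> n < z"
    using mn.IH(1) z(2) by (metis nat.distinct(1))
  moreover have "\<not> z < n"
    using mn.IH(2) z(1) by (metis nat.distinct(1))
  ultimately show ?case by simp
qed (auto elim: reval_RZ reval_RS reval_RId)

text \<open>A property of functions instead of programs: the closure rules below establish
  recursiveness by following the shape of an expression. Arguments of the wrong length are
  unconstrained.\<close>

definition total_rec :: "nat \<Rightarrow> (nat list \<Rightarrow> nat) \<Rightarrow> bool" where
  "total_rec k F \<longleftrightarrow> (\<exists>f. \<forall>xs. length xs = k \<longrightarrow> reval f xs (F xs))"

lemma total_rec_proj: "i < k \<Longrightarrow> total_rec k (\<lambda>xs. xs ! i)"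
  unfolding total_rec_def by (auto intro!: exI[of _ "RId i"] reval.proj)

lemma total_rec_comp:
  assumes "total_rec (length Gs) F" "\<And>G. G \<in> set Gs \<Longrightarrow> total_rec k G"
  shows "total_rec k (\<lambda>xs. F (map (\<lambda>G. G xs) Gs))"
proof -
  obtain f where f: "\<And>xs. length xs = length Gs \<Longrightarrow> reval f xs (F xs)"
    using assms(1) unfolding total_rec_def by blast
  obtain h where h: "\<And>G xs. G \<in> set Gs \<Longrightarrow> length xs = k \<Longrightarrow> reval (h G) xs (G xs)"
    using assms(2) unfolding total_rec_def by metis
  have "reval (RCn f (map h Gs)) xs (F (map (\<lambda>G. G xs) Gs))" if "length xs = k" for xs
    by (rule reval.comp[where ys = "map (\<lambda>G. G xs) Gs"]) (use f h that in auto)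
  then show ?thesis unfolding total_rec_def by blast
qed

definition rec1 :: "(nat \<Rightarrow> nat) \<Rightarrow> bool" where
  "rec1 F \<longleftrightarrow> total_rec 1 (\<lambda>xs. F (xs ! 0))"

definition rec2 :: "(nat \<Rightarrow> nat \<Rightarrow> nat) \<Rightarrow> bool" where
  "rec2 F \<longleftrightarrow> total_rec 2 (\<lambda>xs. F (xs ! 0) (xs ! 1))"

lemma comp1: "rec1 F \<Longrightarrow> total_rec k G \<Longrightarrow> total_rec k (\<lambda>xs. F (G xs))"
  using total_rec_comp[of "[G]" "\<lambda>xs. F (xs ! 0)" k] by (simp add: rec1_def)

lemma comp2: "rec2 F \<Longrightarrow> total_rec k G \<Longrightarrow> total_rec k H \<Longrightarrow> total_rec k (\<lambda>xs. F (G xs) (H xs))"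
  using total_rec_comp[of "[G, H]" "\<lambda>xs. F (xs ! 0) (xs ! 1)" k]
  by (auto simp: rec2_def numeral_2_eq_2)

lemma rec1_Suc: "rec1 Suc"
  unfolding rec1_def total_rec_def
  by (auto intro!: exI[of _ RS] reval.succ simp: length_Suc_conv)

lemma total_rec_const: "total_rec k (\<lambda>_. c)"
proof (induction c)
  case 0
  then show ?case unfolding total_rec_def by (auto intro: reval.zero)
next
  case (Suc c)
  from comp1[OF rec1_Suc this] show ?case .
qed

lemma total_rec_primrec:
  assumes "total_rec k B" "total_rec (Suc (Suc k)) S"
  shows "total_rec (Suc k) (\<lambda>xs. rec_nat (B (tl xs)) (\<lambda>n r. S (n # r # tl xs)) (xs ! 0))"
proof -
  obtain f where f: "\<And>xs. length xs = k \<Longrightarrow> reval f xs (B xs)"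
    using assms(1) unfolding total_rec_def by blast
  obtain g where g: "\<And>xs. length xs = Suc (Suc k) \<Longrightarrow> reval g xs (S xs)"
    using assms(2) unfolding total_rec_def by blast
  have "reval (RPr f g) (n # xs) (rec_nat (B xs) (\<lambda>n r. S (n # r # xs)) n)" if "length xs = k" for n xs
  proof (induction n)
    case 0
    show ?case using f that by (auto intro: reval.pr0)
  next
    case (Suc n)
    show ?case using reval.prS[OF Suc g] that by simp
  qed
  then show ?thesis
    unfolding total_rec_def by (intro exI[of _ "RPr f g"]) (auto simp: length_Suc_conv)
qed

lemma rec1_primrec:
  assumes "total_rec 2 (\<lambda>xs. S (xs ! 0) (xs ! 1))"
  shows "rec1 (\<lambda>n. rec_nat c (\<lambda>m r. S m r) n)"
  using total_rec_primrec[OF total_rec_const[of 0 c], of "\<lambda>xs. S (xs ! 0) (xs ! 1)"] assms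
  by (simp add: rec1_def numeral_2_eq_2)

lemma rec2_primrec:
  assumes "rec1 B" "total_rec 3 (\<lambda>xs. S (xs ! 0) (xs ! 1) (xs ! 2))"
  shows "rec2 (\<lambda>n a. rec_nat (B a) (\<lambda>m r. S m r a) n)"
proof -
  have "total_rec 2 (\<lambda>xs. rec_nat (B (tl xs ! 0)) (\<lambda>m r. S m r (tl xs ! 0)) (xs ! 0))"
    using total_rec_primrec[of 1 "\<lambda>xs. B (xs ! 0)" "\<lambda>xs. S (xs ! 0) (xs ! 1) (xs ! 2)"] assms
    by (simp add: rec1_def numeral_2_eq_2 numeral_3_eq_3)
  moreover have "length xs = 2 \<Longrightarrow> tl xs ! 0 = xs ! 1" for xs :: "nat list"
    by (cases xs) auto
  ultimately show ?thesis unfolding rec2_def total_rec_def by simp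
qed

text \<open>The assumed zero makes the search halt, and totality of \<open>F\<close> supplies the
  successor values that \<open>reval.mn\<close> demands before it.\<close>

lemma total_rec_least:
  assumes F: "total_rec (Suc k) F" and ex: "\<And>xs. length xs = k \<Longrightarrow> \<exists>n. F (n # xs) = 0"
  shows "total_rec k (\<lambda>xs. LEAST n. F (n # xs) = 0)"
proof -
  obtain f where f: "\<And>xs. length xs = Suc k \<Longrightarrow> reval f xs (F xs)"
    using F unfolding total_rec_def by blast
  have "reval (RMn f) xs (LEAST n. F (n # xs) = 0)" if xs: "length xs = k" for xs
  proof (rule reval.mn)
    have "F ((LEAST n. F (n # xs) = 0) # xs) = 0" using ex[OF xs] by (rule LeastI_ex)
    then show "reval f ((LEAST n. F (n # xs) = 0) # xs) 0" using f xs by (metis length_Cons)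
    show "\<forall>m<LEAST n. F (n # xs) = 0. \<exists>k. reval f (m # xs) (Suc k)"
    proof (intro allI impI)
      fix m assume "m < (LEAST n. F (n # xs) = 0)"
      then have "F (m # xs) \<noteq> 0" using not_less_Least by blast
      then obtain k where "F (m # xs) = Suc k" by (cases "F (m # xs)") auto
      then show "\<exists>k. reval f (m # xs) (Suc k)" using f xs by (metis length_Cons)
    qed
  qed
  then show ?thesis unfolding total_rec_def by blast
qed

lemma rec2_add: "rec2 (+)"
proof -
  have "(\<lambda>n a. rec_nat a (\<lambda>m r. Suc r) n) = ((+) :: nat \<Rightarrow> _)"
  proof (intro ext)
    fix n a :: nat
    show "rec_nat a (\<lambda>m r. Suc r) n = n + a" by (induction n) auto
  qed
  moreover have "rec2 (\<lambda>n a. rec_nat a (\<lambda>m r. Suc r) n)"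
    using rec2_primrec[of "\<lambda>a. a" "\<lambda>m r a. Suc r"]
    by (simp add: rec1_def total_rec_proj comp1[OF rec1_Suc])
  ultimately show ?thesis by simp
qed

lemma rec1_pred: "rec1 (\<lambda>n. n - 1)"
proof -
  have "(\<lambda>n. rec_nat 0 (\<lambda>m r. m) n) = (\<lambda>n::nat. n - 1)"
  proof
    fix n :: nat
    show "rec_nat 0 (\<lambda>m r. m) n = n - 1" by (cases n) auto
  qed
  moreover have "rec1 (\<lambda>n. rec_nat 0 (\<lambda>m r. m) n)"
    by (intro rec1_primrec total_rec_proj) simp
  ultimately show ?thesis by simp
qed

lemma rec2_diff: "rec2 (\<lambda>n a. a - n)"
proof -
  have "(\<lambda>n a. rec_nat a (\<lambda>m r. r - 1) n) = (\<lambda>n a::nat. a - n)"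
  proof (intro ext)
    fix n a :: nat
    show "rec_nat a (\<lambda>m r. r - 1) n = a - n" by (induction n) auto
  qed
  moreover have "rec2 (\<lambda>n a. rec_nat a (\<lambda>m r. r - 1) n)"
    by (intro rec2_primrec comp1[OF rec1_pred]) (simp_all add: rec1_def total_rec_proj)
  ultimately show ?thesis by simp
qed

lemma rec2_mult: "rec2 (*)"
proof -
  have "(\<lambda>n a. rec_nat 0 (\<lambda>m r. r + a) n) = ((*) :: nat \<Rightarrow> _)"
  proof (intro ext)
    fix n a :: nat
    show "rec_nat 0 (\<lambda>m r. r + a) n = n * a" by (induction n) auto
  qed
  moreover have "rec2 (\<lambda>n a. rec_nat 0 (\<lambda>m r. r + a) n)"
    by (intro rec2_primrec comp2[OF rec2_add]) (simp_all add: rec1_def total_rec_proj total_rec_const)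
  ultimately show ?thesis by simp
qed

lemma total_rec_Suc: "total_rec k F \<Longrightarrow> total_rec k (\<lambda>xs. Suc (F xs))"
  by (rule comp1[OF rec1_Suc])

lemma
  assumes "total_rec k F" "total_rec k G"
  shows total_rec_add: "total_rec k (\<lambda>xs. F xs + G xs)"
    and total_rec_diff: "total_rec k (\<lambda>xs. F xs - G xs)"
    and total_rec_mult: "total_rec k (\<lambda>xs. F xs * G xs)"
  using comp2[OF rec2_add] comp2[OF rec2_diff] comp2[OF rec2_mult] assms
  by blast+

lemma total_rec_if:
  assumes "total_rec k A" "total_rec k B" "total_rec k C"
  shows "total_rec k (\<lambda>xs. if A xs = 0 then B xs else C xs)"
proof -
  \<comment> \<open>With truncated subtraction, \<open>1 - A xs\<close> is the indicator of
    \<open>A xs = 0\<close>.\<close>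
  have "(\<lambda>xs. if A xs = 0 then B xs else C xs) = (\<lambda>xs. B xs * (1 - A xs) + C xs * (1 - (1 - A xs)))"
    by (auto simp: fun_eq_iff)
  moreover have "total_rec k \<dots>"
    by (intro total_rec_add total_rec_mult total_rec_diff total_rec_const assms)
  ultimately show ?thesis by simp
qed

text \<open>Finite tables are recursive, by altering one value at a time. This handles
  \<open>to_nat\<close> on the alphabet, an otherwise unspecified injection.\<close>

lemma rec1_finite_support:
  assumes "finite {x. G x \<noteq> 0}"
  shows "rec1 G"
proof -
  have "finite A \<Longrightarrow> {x. G x \<noteq> 0} \<subseteq> A \<Longrightarrow> rec1 G" for A
  proof (induction A arbitrary: G rule: finite_induct)
    case empty
    then have "G = (\<lambda>_. 0)" by auto
    then show ?case by (simp add: rec1_def total_rec_const)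
  next
    case (insert c A)
    have "rec1 (G(c := 0))" using insert by (intro insert.IH) auto
    then have "total_rec 1 (\<lambda>xs. if (xs ! 0 - c) + (c - xs ! 0) = 0 then G c else (G(c := 0)) (xs ! 0))"
      by (intro total_rec_if total_rec_add total_rec_diff total_rec_const total_rec_proj)
        (auto simp: rec1_def)
    moreover have "(\<lambda>xs. if (xs ! 0 - c) + (c - xs ! 0) = 0 then G c else (G(c := 0)) (xs ! 0)) =
        (\<lambda>xs. G (xs ! 0))" by auto
    ultimately show ?case by (simp add: rec1_def)
  qed
  then show ?thesis using assms by blast
qed

lemma rec1_triangle: "rec1 triangle"
proof -
  have "(\<lambda>n. rec_nat 0 (\<lambda>m r. r + Suc m) n) = triangle"
  proof
    fix n
    show "rec_nat 0 (\<lambda>m r. r + Suc m) n = triangle n" by (induction n) auto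
  qed
  moreover have "rec1 (\<lambda>n. rec_nat 0 (\<lambda>m r. r + Suc m) n)"
    by (intro rec1_primrec total_rec_add total_rec_Suc total_rec_proj) auto
  ultimately show ?thesis by simp
qed

lemma total_rec_prod_encode:
  assumes "total_rec k F" "total_rec k G"
  shows "total_rec k (\<lambda>xs. prod_encode (F xs, G xs))"
  unfolding prod_encode_def
  by (simp, intro total_rec_add comp1[OF rec1_triangle] assms)

lemma rec1_div:
  assumes b: "0 < b"
  shows "rec1 (\<lambda>m. m div b)"
proof -
  \<comment> \<open>The truncated difference vanishes exactly when
    \<open>m < b * (q + 1)\<close>.\<close>
  have div: "m div b = (LEAST q. Suc m - b * Suc q = 0)" for m
  proof (rule sym, rule Least_equality)
    have "m < b * Suc (m div b)" using b by (metis dividend_less_times_div mult_Suc_right)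
    then show "Suc m - b * Suc (m div b) = 0" by simp
    fix q assume "Suc m - b * Suc q = 0"
    then have "m < Suc q * b" by (simp add: mult.commute)
    then show "m div b \<le> q" using less_mult_imp_div_less[of m "Suc q" b] by simp
  qed
  have "total_rec 1 (\<lambda>xs. LEAST n. (\<lambda>xs. Suc (xs ! 1) - b * Suc (xs ! 0)) (n # xs) = 0)"
  proof (rule total_rec_least)
    show "total_rec (Suc 1) (\<lambda>xs. Suc (xs ! 1) - b * Suc (xs ! 0))"
      by (intro total_rec_diff total_rec_mult total_rec_Suc total_rec_const total_rec_proj) auto
    fix xs :: "nat list"
    have "1 * Suc (xs ! 0) \<le> b * Suc (xs ! 0)" using b by (intro mult_le_mono1) simp
    then have "Suc (xs ! 0) \<le> b * Suc (xs ! 0)" by (simp only: mult_1)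
    then show "\<exists>n. Suc ((n # xs) ! 1) - b * Suc ((n # xs) ! 0) = 0"
      by (intro exI[of _ "xs ! 0"])
        (simp only: nth_Cons_0 nth_Cons_Suc One_nat_def diff_is_0_eq)
  qed
  then show ?thesis by (simp add: rec1_def div)
qed

section \<open>A recursive enumeration of strings by digits\<close>

definition digit :: "nat \<Rightarrow> nat \<Rightarrow> nat \<Rightarrow> nat" where
  "digit b i m = m div b ^ i mod b"

lemma digit_0 [simp]: "digit b 0 m = m mod b"
  by (simp add: digit_def)

lemma digit_Suc [simp]: "digit b (Suc i) m = digit b i (m div b)"
  by (simp add: digit_def div_mult2_eq)

lemma rec2_digit:
  assumes b: "0 < b"
  shows "rec2 (digit b)"
proof -
  have pow: "rec_nat m (\<lambda>_ r. r div b) i = m div b ^ i" for i m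
    by (induction i) (simp_all add: mult.commute flip: div_mult2_eq)
  have "rec2 (\<lambda>i m. rec_nat m (\<lambda>_ r. r div b) i)"
    by (intro rec2_primrec comp1[OF rec1_div[OF b]]) (auto simp: rec1_def total_rec_proj)
  then have r: "total_rec 2 (\<lambda>xs. xs ! 1 div b ^ (xs ! 0))"
    by (simp add: rec2_def pow)
  have "total_rec 2 (\<lambda>xs. xs ! 1 div b ^ (xs ! 0) - b * (xs ! 1 div b ^ (xs ! 0) div b))"
    by (intro total_rec_diff total_rec_mult total_rec_const comp1[OF rec1_div[OF b]] r)
  then show ?thesis by (simp add: rec2_def digit_def minus_mult_div_eq_mod)
qed

text \<open>Strings are enumerated by reading the base-\<open>b\<close> digits of a number as letters, where the
  digit \<open>0\<close> is skipped so that strings of every length occur.\<close>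

primrec digit_string :: "nat \<Rightarrow> (nat \<Rightarrow> 'a) \<Rightarrow> nat \<Rightarrow> nat \<Rightarrow> 'a list" where
  "digit_string b a 0 m = []"
| "digit_string b a (Suc j) m =
     (if digit b j m = 0 then digit_string b a j m else a (digit b j m) # digit_string b a j m)"

text \<open>The defining recursion splits off the highest digit; building a code letter by letter
  requires splitting off the lowest one.\<close>

lemma digit_string_shift:
  "digit_string b a (Suc j) m =
    digit_string b a j (m div b) @ (if m mod b = 0 then [] else [a (m mod b)])"
proof (induction j)
  case (Suc j)
  have "digit_string b a (Suc (Suc j)) m =
    (if digit b (Suc j) m = 0 then digit_string b a (Suc j) m
     else a (digit b (Suc j) m) # digit_string b a (Suc j) m)" by simp
  then show ?case unfolding Suc by simp
qed simp

text \<open>A letter with digit \<open>d\<close> is appended to the string coded by \<open>m\<close>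
  by passing to \<open>d + b * m\<close>. Higher digits are 0 and therefore skipped, so any larger
  number of digits may be read. The bound \<open>length s \<le> m\<close> permits reading
  \<open>m\<close> digits of \<open>m\<close> itself.\<close>

lemma digit_string_surj:
  assumes a: "a ` {1..<b} = UNIV"
  shows "\<exists>m. length s \<le> m \<and> (\<forall>j\<ge>length s. digit_string b a j m = s)"
proof (induction s rule: rev_induct)
  case Nil
  have "digit_string b a j 0 = []" for j by (induction j) (auto simp: digit_def)
  then show ?case by auto
next
  case (snoc x s)
  then obtain m where m: "length s \<le> m" "\<And>j. j \<ge> length s \<Longrightarrow> digit_string b a j m = s" by blast
  obtain d where d: "x = a d" "1 \<le> d" "d < b" using a by (metis UNIV_I atLeastLessThan_iff imageE)
  define m' where "m' = d + b * m"
  have m': "m' mod b = d" "m' div b = m" using d by (auto simp: m'_def)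
  have "m \<le> b * m" using d by simp
  then have "length (s @ [x]) \<le> m'"
    using d(2) m(1) unfolding m'_def length_append_singleton by linarith
  moreover have "digit_string b a j m' = s @ [x]" if "j \<ge> length (s @ [x])" for j
  proof -
    from that obtain i where i: "j = Suc i" "i \<ge> length s" by (cases j) auto
    show ?thesis unfolding i(1) digit_string_shift using m' d m(2)[OF i(2)] by simp
  qed
  ultimately show ?case by blast
qed

text \<open>Inverting a code is a search over strings, but not every number is the
  \<open>enc_str\<close> of a string. The search therefore runs over an index from which the code of
  a string is computable.\<close>

lemma recursive_enumeration:
  "\<exists>S :: nat \<Rightarrow> 'a::finite list. surj S \<and> rec1 (\<lambda>m. enc_str (S m))"
proof -
  \<comment> \<open>One digit for each letter, and the digit 0 as a blank.\<close>
  define b where "b = Suc CARD('a)"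
  have b: "0 < b" by (simp add: b_def)
  obtain a0 :: "nat \<Rightarrow> 'a" where a0: "bij_betw a0 {0..<CARD('a)} UNIV"
    using ex_bij_betw_nat_finite[of "UNIV :: 'a set"] by auto
  define a where "a d = a0 (d - 1)" for d
  have "{0..<CARD('a)} = (\<lambda>d. d - 1) ` {1..<b}"
    by (auto simp: b_def image_iff intro!: bexI[of _ "Suc _"])
  then have a: "a ` {1..<b} = UNIV"
    using bij_betw_imp_surj_on[OF a0] by (simp add: a_def image_image)
  define c where "c d = (if d < b then to_nat (a d) else 0)" for d
  have c: "rec1 c"
    by (rule rec1_finite_support, rule finite_subset[of _ "{..<b}"]) (auto simp: c_def)
  \<comment> \<open>\<open>Suc (prod_encode (x, r))\<close> is the list code obtained by prepending
    \<open>x\<close> to the list with code \<open>r\<close>.\<close>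
  have L: "rec_nat 0 (\<lambda>i r. if digit b i m = 0 then r else Suc (prod_encode (c (digit b i m), r))) j =
      enc_str (digit_string b a j m)" for j m
  proof (induction j)
    case (Suc j)
    have "digit b j m < b" using b by (simp add: digit_def)
    then show ?case using Suc by (simp add: enc_str_def c_def)
  qed (simp add: enc_str_def)
  have "rec2 (\<lambda>j m. rec_nat 0 (\<lambda>i r. if digit b i m = 0 then r else Suc (prod_encode (c (digit b i m), r))) j)"
    by (intro rec2_primrec total_rec_if total_rec_Suc total_rec_prod_encode comp1[OF c]
        comp2[OF rec2_digit[OF b]])
      (simp_all add: rec1_def total_rec_proj total_rec_const)
  then have "rec2 (\<lambda>j m. enc_str (digit_string b a j m))" by (simp add: L)
  then have "rec1 (\<lambda>m. enc_str (digit_string b a m m))"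
    using comp2[of _ 1 "\<lambda>xs. xs ! 0" "\<lambda>xs. xs ! 0"] by (simp add: rec1_def total_rec_proj)
  moreover have "surj (\<lambda>m. digit_string b a m m)"
    using digit_string_surj[OF a] by (metis surjI surj_def)
  ultimately show ?thesis by blast
qed

lemma enc_bits_inject: "enc_bits p = enc_bits q \<longleftrightarrow> p = q"
  unfolding enc_bits_def list_encode_eq by (rule inj_map_eq_map) (auto simp: inj_def)

text \<open>On input p, search for the first n with \<open>Z (S n) = p\<close> and output the code
  of \<open>S n\<close>. Outside the range of \<open>Z\<close> the search never halts, as the value
  \<open>None\<close> demands.\<close>

theorem inverse_partial_recursive:
  fixes Z :: "'a::finite list \<Rightarrow> bool list"
  assumes "inj Z" "recursive_fun Z"
  shows "partial_recursive_machine (\<lambda>p. if p \<in> range Z then Some (inv Z p) else None)"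
proof -
  obtain S :: "nat \<Rightarrow> 'a list" where S: "surj S" "rec1 (\<lambda>m. enc_str (S m))"
    using recursive_enumeration by blast
  obtain fZ where fZ: "\<And>s. reval fZ [enc_str s] (enc_bits (Z s))"
    using assms(2) unfolding recursive_fun_def by blast
  obtain e where e: "\<And>m. reval e [m] (enc_str (S m))"
    using S(2) unfolding rec1_def total_rec_def by (metis One_nat_def length_Cons list.size(3) nth_Cons_0)
  have "reval (RCn fZ [e]) [m] (enc_bits (Z (S m)))" for m
    by (rule reval.comp[where ys = "[enc_str (S m)]"]) (use e fZ in auto)
  then have "rec1 (\<lambda>m. enc_bits (Z (S m)))"
    unfolding rec1_def total_rec_def by (intro exI[of _ "RCn fZ [e]"]) (auto simp: length_Suc_conv)
  then have "total_rec 2 (\<lambda>xs. (enc_bits (Z (S (xs ! 0))) - xs ! 1) + (xs ! 1 - enc_bits (Z (S (xs ! 0)))))"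
    by (intro total_rec_add total_rec_diff total_rec_proj comp1[of "\<lambda>m. enc_bits (Z (S m))"]) auto
  then obtain h where "\<And>xs. length xs = 2 \<Longrightarrow>
      reval h xs ((enc_bits (Z (S (xs ! 0))) - xs ! 1) + (xs ! 1 - enc_bits (Z (S (xs ! 0)))))"
    unfolding total_rec_def by blast
  from this[of "[_, _]"] have h: "reval h [n, x] ((enc_bits (Z (S n)) - x) + (x - enc_bits (Z (S n))))" for n x
    by simp
  define f where "f = RCn e [RMn h]"
  have f: "reval f [enc_bits (Z s)] (enc_str s)" for s
  proof -
    \<comment> \<open>Injectivity of \<open>Z\<close> makes this also the first n with
      \<open>Z (S n) = Z s\<close>, which is what the machine finds.\<close>
    define n where "n = (LEAST n. S n = s)"
    have n: "S n = s" unfolding n_def using S(1) by (metis (mono_tags) LeastI surj_def)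
    have "reval (RMn h) [enc_bits (Z s)] n"
    proof (rule reval.mn)
      show "reval h [n, enc_bits (Z s)] 0" using h[of n "enc_bits (Z s)"] n by simp
      show "\<forall>m<n. \<exists>k. reval h [m, enc_bits (Z s)] (Suc k)"
      proof (intro allI impI)
        fix m assume "m < n"
        then have "S m \<noteq> s" unfolding n_def by (rule not_less_Least)
        then have "enc_bits (Z (S m)) \<noteq> enc_bits (Z s)"
          using assms(1) by (simp add: enc_bits_inject inj_eq)
        then have "\<exists>k. (enc_bits (Z (S m)) - enc_bits (Z s)) + (enc_bits (Z s) - enc_bits (Z (S m))) = Suc k"
          by presburger
        with h[of m "enc_bits (Z s)"] show "\<exists>k. reval h [m, enc_bits (Z s)] (Suc k)" by metis
      qed
    qed
    then show ?thesis
      unfolding f_def using e[of n] n by (intro reval.comp[where ys = "[n]"]) auto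
  qed
  have "p \<in> range Z" if "reval f [enc_bits p] y" for p y
  proof -
    obtain ys where ys: "length ys = 1" "reval (RMn h) [enc_bits p] (ys ! 0)"
      using \<open>reval f [enc_bits p] y\<close> unfolding f_def by (auto elim: reval_RCn)
    then have "reval h [ys ! 0, enc_bits p] 0" by (auto elim: reval_RMn)
    from reval_deterministic[OF this h] have "enc_bits (Z (S (ys ! 0))) = enc_bits p" by simp
    then show ?thesis by (auto simp: enc_bits_inject)
  qed
  then have "reval f [enc_bits p] y \<longleftrightarrow>
      (\<exists>s. (if p \<in> range Z then Some (inv Z p) else None) = Some s \<and> enc_str s = y)" for p y
    using f reval_deterministic[OF f] inv_f_f[OF assms(1)] by (auto simp: image_iff)
  then show ?thesis unfolding partial_recursive_machine_def by blast
qed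

section \<open>Stationary sources\<close>

lemma length_prefix_of [simp]: "length (prefix_of \<omega> n) = n"
  by (simp add: prefix_of_def)

lemma shift_funpow: "(shift ^^ n) \<omega> i = \<omega> (n + i)"
  by (induction n arbitrary: i) (simp_all add: shift_def)

lemma prefix_of_Suc: "prefix_of \<omega> (Suc n) = \<omega> 0 # prefix_of (shift \<omega>) n"
  by (simp add: prefix_of_def shift_def upt_conv_Cons map_Suc_upt[symmetric] comp_def del: upt_Suc)

lemma take_prefix_of: "m \<le> n \<Longrightarrow> take m (prefix_of \<omega> n) = prefix_of \<omega> m"
  by (simp add: prefix_of_def take_map)

lemma take_drop_prefix_of:
  "i + l \<le> n \<Longrightarrow> take l (drop i (prefix_of \<omega> n)) = prefix_of ((shift ^^ i) \<omega>) l"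
  by (rule nth_equalityI) (auto simp: prefix_of_def shift_funpow)

lemma words_UNIV: "words UNIV n = {w. length w = n}"
  by (auto simp: words_def)

definition cylinder_set :: "(nat \<Rightarrow> 'a) set \<Rightarrow> bool" where
  "cylinder_set B \<longleftrightarrow> (\<exists>m S. B = {\<omega>. prefix_of \<omega> m \<in> S})"

lemma finite_cylinder_sets_common_length:
  assumes "finite F" "\<And>A. A \<in> F \<Longrightarrow> cylinder_set (B A)"
  shows "\<exists>m S. \<forall>A\<in>F. B A = {\<omega>. prefix_of \<omega> m \<in> S A}"
proof -
  have "\<forall>A\<in>F. \<exists>z. B A = {\<omega>. prefix_of \<omega> (fst z) \<in> snd z}"
    using assms(2) unfolding cylinder_set_def by auto
  from bchoice[OF this] obtain z where z: "\<forall>A\<in>F. B A = {\<omega>. prefix_of \<omega> (fst (z A)) \<in> snd (z A)}" ..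
  define m where "m A = fst (z A)" for A
  define S where "S A = snd (z A)" for A
  have mS: "B A = {\<omega>. prefix_of \<omega> (m A) \<in> S A}" if "A \<in> F" for A
    using z that by (simp add: m_def S_def)
  \<comment> \<open>The sum serves merely as an upper bound for all the lengths.\<close>
  define n where "n = (\<Sum>A\<in>F. m A)"
  have "B A = {\<omega>. prefix_of \<omega> n \<in> {w. take (m A) w \<in> S A}}" if "A \<in> F" for A
  proof -
    have "m A \<le> n" unfolding n_def using assms(1) that by (intro member_le_sum) auto
    then show ?thesis using mS[OF that] by (simp add: take_prefix_of)
  qed
  then show ?thesis by (intro exI[of _ n] exI[of _ "\<lambda>A. {w. take (m A) w \<in> S A}"]) simp
qed

lemma cylinder_set_UN:
  assumes "finite F" "\<And>A. A \<in> F \<Longrightarrow> cylinder_set (B A)"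
  shows "cylinder_set (\<Union>A\<in>F. B A)"
proof -
  obtain m S where "\<forall>A\<in>F. B A = {\<omega>. prefix_of \<omega> m \<in> S A}"
    using finite_cylinder_sets_common_length[of F B] assms by blast
  then have "(\<Union>A\<in>F. B A) = {\<omega>. prefix_of \<omega> m \<in> (\<Union>A\<in>F. S A)}" by auto
  then show ?thesis unfolding cylinder_set_def by blast
qed

locale stationary_source = measure_preserving \<mu> shift
  for \<mu> :: "(nat \<Rightarrow> 'a::finite) measure" +
  assumes sets_mu: "sets \<mu> = sets (Pi\<^sub>M UNIV (\<lambda>_. count_space (UNIV :: 'a set)))"
begin

lemma space_mu [simp]: "space \<mu> = UNIV"
  using sets_eq_imp_space_eq[OF sets_mu] by (simp add: space_PiM)

definition first :: "(nat \<Rightarrow> 'a) \<Rightarrow> 'a" where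
  "first \<omega> = \<omega> 0"

lemma simple_function_first: "simple_function \<mu> first"
proof -
  have "(\<lambda>\<omega>. \<omega> 0) \<in> measurable (Pi\<^sub>M UNIV (\<lambda>_. count_space (UNIV :: 'a set))) (count_space UNIV)"
    by (rule measurable_component_singleton) simp
  then have "first \<in> measurable \<mu> (count_space UNIV)"
    unfolding first_def[abs_def] using measurable_cong_sets[OF sets_mu refl] by blast
  then show ?thesis
    unfolding simple_function_def by (simp add: measurable_sets del: space_mu)
qed

lemma itinerary_first: "itinerary first n \<omega> = prefix_of \<omega> n"
  by (simp add: itinerary_def first_def prefix_of_def shift_funpow)

lemma simple_function_prefix_of: "simple_function \<mu> (\<lambda>\<omega>. prefix_of \<omega> n)"
  using simple_function_itinerary[OF simple_function_first, of n]
  by (simp add: itinerary_first[abs_def])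

lemma measurable_prefix_of [measurable]: "(\<lambda>\<omega>. prefix_of \<omega> n) \<in> measurable \<mu> (count_space UNIV)"
  using simple_function_prefix_of by (rule measurable_simple_function)

text \<open>Words carry the discrete sigma-algebra, so \<open>F\<close> is arbitrary. Measurability
  of \<open>K_Z\<close> and \<open>K_AIC\<close> comes from here.\<close>

lemma borel_measurable_of_prefix [measurable]:
  fixes F :: "'a list \<Rightarrow> real"
  shows "(\<lambda>\<omega>. F (prefix_of \<omega> n)) \<in> borel_measurable \<mu>"
  by (rule measurable_compose[OF measurable_prefix_of]) simp

lemma cylinder_set_events: "cylinder_set B \<Longrightarrow> B \<in> events"
  unfolding cylinder_set_def using measurable_sets[OF measurable_prefix_of] by (auto simp: vimage_def)

text \<open>Induction on the generation of the sigma-algebra: the approximable sets contain the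
  generators and are closed under complements and countable unions. The accuracy is generalised, as
  the union case needs finer approximations.\<close>

lemma approximate_by_cylinder_set:
  assumes A: "A \<in> events" and e: "0 < e"
  shows "\<exists>B. cylinder_set B \<and> prob ((A - B) \<union> (B - A)) < e"
proof -
  define G where "G = {{f \<in> \<Pi>\<^sub>E i\<in>UNIV. space (count_space (UNIV :: 'a set)). f i \<in> X} |i X.
     i \<in> (UNIV :: nat set) \<and> X \<in> sets (count_space (UNIV :: 'a set))}"
  have G: "events = sigma_sets UNIV G"
    unfolding sets_mu sets_PiM_single G_def by simp
  have "A \<in> sigma_sets UNIV G" using A G by simp
  then show ?thesis
    using e
  proof (induction arbitrary: e rule: sigma_sets.induct)
    case (Basic A)
    then obtain i X where "A = {f. f i \<in> X}" unfolding G_def by auto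
    then have "A = {\<omega>. prefix_of \<omega> (Suc i) \<in> {w. w ! i \<in> X}}"
      by (auto simp: prefix_of_def simp del: upt_Suc)
    then have "cylinder_set A" unfolding cylinder_set_def by blast
    then show ?case using Basic.prems by (intro exI[of _ A]) simp
  next
    case Empty
    have "cylinder_set {}" unfolding cylinder_set_def by (intro exI[of _ 0] exI[of _ "{}"]) simp
    then show ?case using Empty by (intro exI[of _ "{}"]) simp
  next
    case (Compl A)
    then obtain B where B: "cylinder_set B" "prob ((A - B) \<union> (B - A)) < e" by blast
    then obtain m S where "B = {\<omega>. prefix_of \<omega> m \<in> S}" unfolding cylinder_set_def by blast
    then have "- B = {\<omega>. prefix_of \<omega> m \<in> - S}" by auto
    then have "cylinder_set (- B)" unfolding cylinder_set_def by blast
    moreover have "((UNIV - A) - (- B)) \<union> (- B - (UNIV - A)) = (A - B) \<union> (B - A)" by auto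
    ultimately show ?case using B(2) by (intro exI[of _ "- B"]) simp
  next
    case (Union A)
    have Am: "A i \<in> events" for i using Union.hyps G by simp
    define U where "U = (\<Union>i. A i)"
    define V where "V n = (\<Union>i<n. A i)" for n
    have [measurable]: "U \<in> events" "V n \<in> events" for n unfolding U_def V_def using Am by auto
    have "(\<lambda>n. prob (U - V n)) \<longlonglongrightarrow> prob (\<Inter>n. U - V n)"
    proof (rule finite_Lim_measure_decseq)
      have "U - V n \<in> events" for n by measurable
      then show "range (\<lambda>n. U - V n) \<subseteq> events" by blast
      show "decseq (\<lambda>n. U - V n)" by (fastforce simp: decseq_def V_def)
    qed
    moreover have "(\<Inter>n. U - V n) = {}" unfolding U_def V_def by auto
    ultimately have "(\<lambda>n. prob (U - V n)) \<longlonglongrightarrow> 0" by (simp only: measure_empty)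
    then have "eventually (\<lambda>n. prob (U - V n) < e / 2) sequentially"
      using Union.prems by (intro order_tendstoD) auto
    then obtain n where n: "prob (U - V n) < e / 2" by (auto simp: eventually_sequentially)
    \<comment> \<open>Half of the error pays for truncating the union after \<open>n\<close> sets;
      the other half is shared among these sets.\<close>
    have "\<forall>i. \<exists>B. cylinder_set B \<and> prob ((A i - B) \<union> (B - A i)) < e / (2 * (real n + 1))"
      using Union.IH Union.prems by simp
    from choice[OF this] obtain B where B: "\<And>i. cylinder_set (B i)"
      "\<And>i. prob ((A i - B i) \<union> (B i - A i)) < e / (2 * (real n + 1))" by blast
    define W where "W = (\<Union>i<n. B i)"
    have Bm [measurable]: "B i \<in> events" for i using B(1) by (rule cylinder_set_events)
    note [measurable] = Am
    have "prob ((U - W) \<union> (W - U)) \<le> prob ((U - V n) \<union> (\<Union>i<n. (A i - B i) \<union> (B i - A i)))"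
      by (rule finite_measure_mono) (auto simp: U_def V_def W_def)
    also have "\<dots> \<le> prob (U - V n) + prob (\<Union>i<n. (A i - B i) \<union> (B i - A i))"
      by (rule measure_Un_le) auto
    also have "prob (\<Union>i<n. (A i - B i) \<union> (B i - A i)) \<le> (\<Sum>i<n. prob ((A i - B i) \<union> (B i - A i)))"
      by (rule finite_measure_subadditive_finite) auto
    also have "\<dots> \<le> (\<Sum>i<n. e / (2 * (real n + 1)))"
      using B(2) by (intro sum_mono less_imp_le)
    also have "\<dots> \<le> e / 2" using Union.prems by (simp add: field_simps)
    finally have "prob ((U - W) \<union> (W - U)) < e" using n by simp
    moreover have "cylinder_set W" unfolding W_def by (rule cylinder_set_UN) (auto intro: B)
    ultimately show ?case unfolding U_def by blast
  qed
qed

text \<open>Every cell is approximated by a cylinder set. Off the union of the symmetric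
  differences, membership in a cell can be read from the prefix, so exactly one candidate cell fits
  and \<open>g\<close> finds it.\<close>

lemma partition_approximation:
  assumes P: "finite_meas_partition \<mu> P" and e: "0 < e"
  shows "\<exists>m g. prob {\<omega> \<in> space \<mu>. cell_of P \<omega> \<noteq> g (prefix_of \<omega> m)} < e"
proof -
  have fin: "finite P" and ev: "P \<subseteq> events" using P by (auto simp: finite_meas_partition_def)
  define d where "d = e / (real (card P) + 1)"
  have d: "0 < d" using e by (simp add: d_def)
  have "\<forall>A\<in>P. \<exists>B. cylinder_set B \<and> prob ((A - B) \<union> (B - A)) < d"
    using approximate_by_cylinder_set ev d by blast
  from bchoice[OF this] obtain B where B: "\<And>A. A \<in> P \<Longrightarrow> cylinder_set (B A)"
    "\<And>A. A \<in> P \<Longrightarrow> prob ((A - B A) \<union> (B A - A)) < d" by blast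
  have "\<exists>m S. \<forall>A\<in>P. B A = {\<omega>. prefix_of \<omega> m \<in> S A}"
    by (rule finite_cylinder_sets_common_length) (use fin B in auto)
  then obtain m S where mS: "\<forall>A\<in>P. B A = {\<omega>. prefix_of \<omega> m \<in> S A}"
    by (elim exE)
  define g where "g w = (THE A. A \<in> P \<and> w \<in> S A)" for w
  define D where "D = (\<Union>A\<in>P. (A - B A) \<union> (B A - A))"
  have Dev: "(A - B A) \<union> (B A - A) \<in> events" if "A \<in> P" for A
    using that ev cylinder_set_events[OF B(1)] by (intro sets.Un sets.Diff) auto
  then have Dm: "D \<in> events" unfolding D_def using fin by (intro sets.finite_UN)
  have "cell_of P \<omega> = g (prefix_of \<omega> m)" if "\<omega> \<notin> D" for \<omega>
  proof -
    have iff: "\<omega> \<in> A \<longleftrightarrow> prefix_of \<omega> m \<in> S A" if "A \<in> P" for A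
    proof -
      have "\<omega> \<in> A \<longleftrightarrow> \<omega> \<in> B A" using \<open>\<omega> \<notin> D\<close> that unfolding D_def by blast
      then show ?thesis using mS[rule_format, OF that] by simp
    qed
    have c: "cell_of P \<omega> \<in> P" "\<omega> \<in> cell_of P \<omega>" using cell_of_mem[OF P, of \<omega>] by auto
    have "g (prefix_of \<omega> m) = cell_of P \<omega>"
      unfolding g_def
    proof (rule the_equality)
      show "cell_of P \<omega> \<in> P \<and> prefix_of \<omega> m \<in> S (cell_of P \<omega>)" using c iff by blast
      fix A assume "A \<in> P \<and> prefix_of \<omega> m \<in> S A"
      then show "A = cell_of P \<omega>" using iff cell_of_eq[OF P] by metis
    qed
    then show ?thesis by simp
  qed
  then have "prob {\<omega> \<in> space \<mu>. cell_of P \<omega> \<noteq> g (prefix_of \<omega> m)} \<le> prob D"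
    by (intro finite_measure_mono Dm) auto
  also have "\<dots> \<le> (\<Sum>A\<in>P. prob ((A - B A) \<union> (B A - A)))"
    unfolding D_def by (rule finite_measure_subadditive_finite[OF fin]) (use Dev in blast)
  also have "\<dots> \<le> (\<Sum>A\<in>P. d)" using B(2) by (intro sum_mono less_imp_le)
  also have "\<dots> < e" using e by (simp add: d_def field_simps)
  finally show ?thesis by blast
qed

text \<open>The Kolmogorov-Sinai generator theorem for the shift, by
  \<open>entropy_rate_le_generator\<close> in both directions. Any partition is guessed
  approximately from prefixes; conversely \<open>first\<close> is guessed without error from the
  cells of the partition by first letter.\<close>

lemma ks_entropy_eq_rate: "ks_entropy \<mu> shift = ereal (entropy_rate first)"
  unfolding ks_entropy_def
proof (rule antisym)
  show "(SUP P\<in>{P. finite_meas_partition \<mu> P}. ereal (entropy_wrt_partition \<mu> shift P)) \<le> ereal (entropy_rate first)"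
  proof (rule SUP_least)
    fix P assume "P \<in> {P. finite_meas_partition \<mu> P}"
    then have P: "finite_meas_partition \<mu> P" by simp
    have "entropy_rate (cell_of P) \<le> entropy_rate first"
      using partition_approximation[OF P]
      by (intro entropy_rate_le_generator simple_function_cell_of[OF P] simple_function_first)
        (simp add: itinerary_first)
    then show "ereal (entropy_wrt_partition \<mu> shift P) \<le> ereal (entropy_rate first)"
      by (simp add: entropy_wrt_partition_eq[OF P])
  qed
next
  define P where "P = range (\<lambda>a. first -` {a})"
  have P: "finite_meas_partition \<mu> P"
    using simple_functionD(2)[OF simple_function_first] unfolding finite_meas_partition_def P_def by auto
  have cell: "cell_of P \<omega> = first -` {first \<omega>}" for \<omega>
    by (rule cell_of_eq[OF P]) (auto simp: P_def)
  define g where "g Q = (SOME a. hd Q = first -` {a})" for Q :: "(nat \<Rightarrow> 'a) set list"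
  have "g (itinerary (cell_of P) 1 \<omega>) = first \<omega>" for \<omega>
    unfolding g_def
  proof (rule some_equality)
    show eq: "hd (itinerary (cell_of P) 1 \<omega>) = first -` {first \<omega>}"
      by (simp add: itinerary_def cell)
    fix a assume "hd (itinerary (cell_of P) 1 \<omega>) = first -` {a}"
    with eq have "first -` {a} = first -` {first \<omega>}" by simp
    \<comment> \<open>The constant sequence shows that no cell is empty, so a cell determines its
      letter.\<close>
    moreover have "(\<lambda>_. a) \<in> first -` {a}" by (simp add: first_def)
    ultimately have "(\<lambda>_. a) \<in> first -` {first \<omega>}" by blast
    then show "a = first \<omega>" by (simp add: first_def)
  qed
  then have "{\<omega> \<in> space \<mu>. first \<omega> \<noteq> g (itinerary (cell_of P) 1 \<omega>)} = {}" by simp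
  then have "prob {\<omega> \<in> space \<mu>. first \<omega> \<noteq> g (itinerary (cell_of P) 1 \<omega>)} < e" if "0 < e" for e
    using that by simp
  then have "entropy_rate first \<le> entropy_rate (cell_of P)"
    by (intro entropy_rate_le_generator simple_function_cell_of[OF P] simple_function_first) blast
  then show "ereal (entropy_rate first) \<le> (SUP P\<in>{P. finite_meas_partition \<mu> P}. ereal (entropy_wrt_partition \<mu> shift P))"
    using P by (intro SUP_upper2[of P]) (auto simp: entropy_wrt_partition_eq)
qed

end

section \<open>Empirical entropy and coding\<close>

lemma
  fixes s w :: "'a list"
  shows emp_freq_nonneg: "0 \<le> emp_freq s w" and emp_freq_le_1: "emp_freq s w \<le> 1"
proof -
  let ?I = "{i. i + length w \<le> length s \<and> take (length w) (drop i s) = w}"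
  have "0 \<le> emp_freq s w \<and> emp_freq s w \<le> 1"
  proof (cases "length w \<le> length s")
    case True
    have "card ?I \<le> card {..length s - length w}"
      by (rule card_mono) auto
    then have "real (card ?I) \<le> real (length s) - real (length w) + 1"
      using True by (simp add: of_nat_diff)
    then show ?thesis using True by (simp add: emp_freq_def divide_le_eq)
  next
    case False
    \<comment> \<open>The denominator may be 0 or negative here; the count 0 makes the quotient 0
      anyway.\<close>
    then have "?I = {}" by auto
    then have "card ?I = 0" by (simp only: card.empty)
    then show ?thesis unfolding emp_freq_def by (simp only:) simp
  qed
  then show "0 \<le> emp_freq s w" "emp_freq s w \<le> 1" by auto
qed

lemma emp_entropy_eta:
  "emp_entropy l (s :: 'a::finite list) = (\<Sum>w\<in>words UNIV l. eta (emp_freq s w)) / real l"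
  by (simp add: emp_entropy_def words_UNIV eta_def sum_negf)

lemma emp_entropy_nonneg: "0 \<le> emp_entropy l (s :: 'a::finite list)"
  unfolding emp_entropy_eta
  by (intro divide_nonneg_nonneg sum_nonneg eta_nonneg emp_freq_nonneg emp_freq_le_1) auto

text \<open>A crude termwise bound; what counts is that it does not depend on \<open>s\<close>,
  which keeps the limsup finite.\<close>

lemma emp_entropy_le:
  "emp_entropy l (s :: 'a::finite list) \<le> real (card (words (UNIV :: 'a set) l)) * (1 / ln 2) / real l"
  unfolding emp_entropy_eta
  by (intro divide_right_mono sum_bounded_above eta_le emp_freq_nonneg) auto

lemma emp_entropy_seq_l_eq: "emp_entropy_seq_l l \<omega> = rlimsup (\<lambda>n. emp_entropy l (prefix_of \<omega> n))"
  by (simp add: emp_entropy_seq_l_def rlimsup_def)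

lemma K_Z_eq: "K_Z Z \<omega> = rlimsup (\<lambda>n. real (length (Z (prefix_of \<omega> n))) / real n)"
  by (simp add: K_Z_def rlimsup_def)

lemma K_AIC_eq: "K_AIC C \<omega> = rlimsup (\<lambda>n. real (AIC C (prefix_of \<omega> n)) / real n)"
  by (simp add: K_AIC_def rlimsup_def)

lemma K_Z_le_emp_entropy_seq_l:
  assumes opt: "optimal_coding Z" and k: "k \<ge> 1"
  shows "K_Z Z \<omega> \<le> emp_entropy_seq_l k \<omega>"
proof -
  obtain f where f: "f \<in> o(\<lambda>n. real n)"
    "\<And>s. real (length (Z s)) / real (length s) \<le> emp_entropy k s + f (length s) / real (length s)"
    using opt k unfolding optimal_coding_def by blast
  have "(\<lambda>n. f n / real n) \<longlonglongrightarrow> 0" using f(1) by (rule smalloD_tendsto)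
  moreover have "real (length (Z (prefix_of \<omega> n))) / real n \<le> emp_entropy k (prefix_of \<omega> n) + f n / real n" for n
    using f(2)[of "prefix_of \<omega> n"] by simp
  ultimately show ?thesis
    unfolding K_Z_eq emp_entropy_seq_l_eq
    by (intro rlimsup_le_add[where a = 0] always_eventually allI conjI)
      (auto intro: emp_entropy_nonneg emp_entropy_le)
qed

text \<open>Optimality for blocks of length 1: the empirical entropy is uniformly bounded, and
  \<open>f n / n\<close> is bounded because it converges.\<close>

lemma optimal_coding_linear_bound:
  fixes Z :: "'a::finite list \<Rightarrow> bool list"
  assumes opt: "optimal_coding Z"
  shows "\<exists>B. \<forall>s. s \<noteq> [] \<longrightarrow> real (length (Z s)) / real (length s) \<le> B"
proof -
  obtain f where f: "f \<in> o(\<lambda>n. real n)"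
    "\<And>s. real (length (Z s)) / real (length s) \<le> emp_entropy 1 s + f (length s) / real (length s)"
    using opt unfolding optimal_coding_def by blast
  have "(\<lambda>n. f n / real n) \<longlonglongrightarrow> 0" using f(1) by (rule smalloD_tendsto)
  then have "Bseq (\<lambda>n. f n / real n)" by (rule convergent_imp_Bseq[OF convergentI])
  then obtain K where K: "\<And>n. norm (f n / real n) \<le> K" using BseqE by blast
  have "real (length (Z s)) / real (length s) \<le>
      real (card (words (UNIV :: 'a set) 1)) * (1 / ln 2) / real 1 + K" for s
    using f(2)[of s] emp_entropy_le[of 1 s] K[of "length s"] by (simp only: real_norm_def)
  then show ?thesis by blast
qed

text \<open>Let \<open>q\<close> be the prefix with which \<open>C\<close> simulates the inverse of
  \<open>Z\<close>. Then \<open>q @ Z s\<close> is a program for \<open>s\<close>, and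
  \<open>c\<close> is the length of \<open>q\<close>. That programs exist at all makes the
  \<open>LEAST\<close> in \<open>AIC\<close> meaningful.\<close>

lemma AIC_le_code_length:
  fixes Z :: "'a::finite list \<Rightarrow> bool list"
  assumes C: "universal_machine C" and Z: "reversible_coding Z"
  shows "\<exists>c. \<forall>s. (\<exists>p. C p = Some s) \<and> AIC C s \<le> length (Z s) + c"
proof -
  have inj: "inj Z" using Z by (simp add: reversible_coding_def)
  have "partial_recursive_machine (\<lambda>p. if p \<in> range Z then Some (inv Z p) else None)"
    using Z by (intro inverse_partial_recursive) (auto simp: reversible_coding_def)
  then obtain q where q: "\<And>p. C (q @ p) = (if p \<in> range Z then Some (inv Z p) else None)"
    using C unfolding universal_machine_def by blast
  have s: "C (q @ Z s) = Some s" for s using q inj by simp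
  have "AIC C s \<le> length (Z s) + length q" for s
    unfolding AIC_def by (rule Least_le) (use s[of s] in auto)
  with s show ?thesis by blast
qed

lemma shortest_program:
  assumes "\<exists>p. C p = Some s"
  shows "\<exists>p. C p = Some s \<and> length p = AIC C s"
  unfolding AIC_def by (rule LeastI_ex) (use assms in blast)

section \<open>Limiting word frequencies and the integral inequalities\<close>

context stationary_source
begin

lemma prob_UNIV [simp]: "prob UNIV = 1"
  using prob_space by simp

text \<open>Its integral is the probability of the word, its orbit averages are empirical
  frequencies.\<close>

definition occurs :: "'a list \<Rightarrow> (nat \<Rightarrow> 'a) \<Rightarrow> real" where
  "occurs w \<omega> = of_bool (prefix_of \<omega> (length w) = w)"

lemma occurs_measurable [measurable]: "occurs w \<in> borel_measurable \<mu>"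
  using borel_measurable_of_prefix[of "\<lambda>v. of_bool (v = w)" "length w"] by (simp add: occurs_def[abs_def])

lemma occurs_bounds: "\<omega> \<in> space \<mu> \<Longrightarrow> 0 \<le> occurs w \<omega> \<and> occurs w \<omega> \<le> 1"
  by (simp add: occurs_def)

lemma integral_occurs: "(\<integral>\<omega>. occurs w \<omega> \<partial>\<mu>) = prob ((\<lambda>\<omega>. prefix_of \<omega> (length w)) -` {w} \<inter> space \<mu>)"
proof -
  have "(\<integral>\<omega>. occurs w \<omega> \<partial>\<mu>) = (\<integral>\<omega>. indicator ((\<lambda>\<omega>. prefix_of \<omega> (length w)) -` {w}) \<omega> \<partial>\<mu>)"
    by (intro Bochner_Integration.integral_cong) (auto simp: occurs_def indicator_def)
  then show ?thesis by simp
qed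

lemma emp_freq_prefix_of:
  assumes "length w \<le> n"
  shows "emp_freq (prefix_of \<omega> n) w = birkhoff_sum (occurs w) (Suc (n - length w)) \<omega> / real (Suc (n - length w))"
proof -
  have "{i. i + length w \<le> length (prefix_of \<omega> n) \<and> take (length w) (drop i (prefix_of \<omega> n)) = w}
      = {i \<in> {..<Suc (n - length w)}. prefix_of ((shift ^^ i) \<omega>) (length w) = w}"
    using assms by (auto simp: take_drop_prefix_of)
  then show ?thesis
    using assms by (simp add: emp_freq_def birkhoff_sum_def occurs_def of_nat_diff
        sum.If_cases of_bool_def Int_def del: sum.lessThan_Suc)
qed

text \<open>The upper average is defined and measurable everywhere, including where the frequencies
  do not converge.\<close>

definition limit_freq :: "(nat \<Rightarrow> 'a) \<Rightarrow> 'a list \<Rightarrow> real" where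
  "limit_freq \<omega> w = upper_average (occurs w) \<omega>"

lemma limit_freq_measurable [measurable]: "(\<lambda>\<omega>. limit_freq \<omega> w) \<in> borel_measurable \<mu>"
  unfolding limit_freq_def by measurable

lemma limit_freq_bounds: "0 \<le> limit_freq \<omega> w" "limit_freq \<omega> w \<le> 1"
  unfolding limit_freq_def using upper_average_nonneg[OF occurs_bounds] upper_average_le_1[OF occurs_bounds]
  by auto

definition generic :: "(nat \<Rightarrow> 'a) \<Rightarrow> bool" where
  "generic \<omega> \<longleftrightarrow> (\<forall>w. (\<lambda>n. birkhoff_sum (occurs w) n \<omega> / real n) \<longlonglongrightarrow> limit_freq \<omega> w)"

text \<open>There are only countably many words, so the exceptional null sets of Birkhoff's theorem
  can be united.\<close>

lemma AE_generic: "AE \<omega> in \<mu>. generic \<omega>"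
  unfolding generic_def limit_freq_def AE_all_countable
  using birkhoff(1)[OF occurs_measurable occurs_bounds] by blast

lemma sum_occurs_append: "(\<Sum>a\<in>UNIV. occurs (w @ [a]) \<omega>) = occurs w \<omega>"
proof -
  have "occurs (w @ [a]) \<omega> = (if a = \<omega> (length w) then occurs w \<omega> else 0)" for a
    by (auto simp: occurs_def prefix_of_def)
  then show ?thesis by simp
qed

lemma sum_occurs_Cons: "(\<Sum>a\<in>UNIV. occurs (a # w) \<omega>) = occurs w (shift \<omega>)"
proof -
  have "occurs (a # w) \<omega> = (if a = \<omega> 0 then occurs w (shift \<omega>) else 0)" for a
    by (auto simp: occurs_def prefix_of_Suc)
  then show ?thesis by simp
qed

text \<open>Summing over the last letter is exact already for finite averages. Summing over the
  first letter yields the averages along the shifted sequence, which differ by at most 1/n.\<close>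

lemma generic_stationary_weights:
  assumes "generic \<omega>"
  shows "stationary_weights (UNIV :: 'a set) (limit_freq \<omega>)"
proof
  have lim: "(\<lambda>n. birkhoff_sum (occurs w) n \<omega> / real n) \<longlonglongrightarrow> limit_freq \<omega> w" for w
    using assms by (simp add: generic_def)
  have sum_lim: "(\<lambda>n. birkhoff_sum (\<lambda>x. \<Sum>a\<in>UNIV. occurs (v a) x) n \<omega> / real n) \<longlonglongrightarrow>
      (\<Sum>a\<in>UNIV. limit_freq \<omega> (v a))" for v :: "'a \<Rightarrow> 'a list"
  proof -
    have "birkhoff_sum (\<lambda>x. \<Sum>a\<in>UNIV. occurs (v a) x) n \<omega> / real n =
        (\<Sum>a\<in>UNIV. birkhoff_sum (occurs (v a)) n \<omega> / real n)" for n
      unfolding birkhoff_sum_def by (subst sum.swap) (simp add: sum_divide_distrib)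
    then show ?thesis by (simp add: tendsto_sum lim)
  qed
  show "finite (UNIV :: 'a set)" by simp
  show "0 \<le> limit_freq \<omega> w" for w by (rule limit_freq_bounds)
  have "eventually (\<lambda>n. birkhoff_sum (occurs []) n \<omega> / real n = 1) sequentially"
    using eventually_ge_at_top[of 1]
    by eventually_elim (simp add: birkhoff_sum_def occurs_def prefix_of_def)
  then have "(\<lambda>n. birkhoff_sum (occurs []) n \<omega> / real n) \<longlonglongrightarrow> 1" by (rule tendsto_eventually)
  with lim show "limit_freq \<omega> [] = 1" using LIMSEQ_unique by blast
  fix w :: "'a list"
  show "(\<Sum>a\<in>UNIV. limit_freq \<omega> (w @ [a])) = limit_freq \<omega> w"
    using sum_lim[of "\<lambda>a. w @ [a]"] lim[of w] LIMSEQ_unique by (auto simp: sum_occurs_append)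
  have "(\<lambda>n. birkhoff_sum (occurs w) n (shift \<omega>) / real n - birkhoff_sum (occurs w) n \<omega> / real n) \<longlonglongrightarrow> 0"
  proof (rule Lim_null_comparison)
    show "eventually (\<lambda>n. norm (birkhoff_sum (occurs w) n (shift \<omega>) / real n -
        birkhoff_sum (occurs w) n \<omega> / real n) \<le> 1 / real n) sequentially"
      using birkhoff_average_T_diff[where x = \<omega>, OF occurs_bounds] by simp
    show "(\<lambda>n. 1 / real n) \<longlonglongrightarrow> 0" by real_asymp
  qed
  from tendsto_add[OF this lim[of w]]
  have "(\<lambda>n. birkhoff_sum (occurs w) n (shift \<omega>) / real n) \<longlonglongrightarrow> limit_freq \<omega> w" by simp
  moreover have "birkhoff_sum (\<lambda>x. \<Sum>a\<in>UNIV. occurs (a # w) x) n \<omega> = birkhoff_sum (occurs w) n (shift \<omega>)" for n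
    by (simp add: birkhoff_sum_def sum_occurs_Cons funpow_swap1)
  ultimately show "(\<Sum>a\<in>UNIV. limit_freq \<omega> (a # w)) = limit_freq \<omega> w"
    using sum_lim[of "\<lambda>a. a # w"] LIMSEQ_unique by auto
qed

text \<open>At a generic sequence the empirical frequencies converge, and continuity of
  \<open>eta\<close> turns the limsup into a limit.\<close>

lemma generic_emp_entropy_seq_l:
  assumes "generic \<omega>"
  shows "emp_entropy_seq_l l \<omega> = block_entropy UNIV (limit_freq \<omega>) l / real l"
proof -
  have freq: "(\<lambda>n. emp_freq (prefix_of \<omega> n) w) \<longlonglongrightarrow> limit_freq \<omega> w" for w
  proof -
    \<comment> \<open>A prefix of length \<open>n + length w\<close> has exactly n + 1 windows of
      the length of \<open>w\<close>.\<close>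
    have "(\<lambda>n. birkhoff_sum (occurs w) (Suc n) \<omega> / real (Suc n)) \<longlonglongrightarrow> limit_freq \<omega> w"
      using assms unfolding generic_def by (intro LIMSEQ_Suc) blast
    then have "(\<lambda>n. emp_freq (prefix_of \<omega> (n + length w)) w) \<longlonglongrightarrow> limit_freq \<omega> w"
      by (simp add: emp_freq_prefix_of)
    then show ?thesis by (rule LIMSEQ_offset)
  qed
  have "(\<lambda>n. (\<Sum>w\<in>words UNIV l. eta (emp_freq (prefix_of \<omega> n) w)) / real l) \<longlonglongrightarrow>
      (\<Sum>w\<in>words UNIV l. eta (limit_freq \<omega> w)) / real l"
    unfolding divide_inverse
    by (intro tendsto_mult_right tendsto_sum tendsto_eta emp_freq_nonneg freq)
  then show ?thesis
    unfolding emp_entropy_seq_l_eq emp_entropy_eta block_entropy_def by (rule rlimsup_eq_lim)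
qed

text \<open>Subadditivity of the block entropies of the limiting frequencies makes the
  \<open>lim\<close> in \<open>emp_entropy_seq_def\<close> a genuine limit, which is also a lower
  bound.\<close>

lemma generic_emp_entropy_seq:
  assumes "generic \<omega>"
  shows "(\<lambda>l. emp_entropy_seq_l l \<omega>) \<longlonglongrightarrow> emp_entropy_seq \<omega>"
    and "l \<ge> 1 \<Longrightarrow> emp_entropy_seq \<omega> \<le> emp_entropy_seq_l l \<omega>"
proof -
  interpret stationary_weights UNIV "limit_freq \<omega>"
    using assms by (rule generic_stationary_weights)
  obtain L where L: "(\<lambda>l. emp_entropy_seq_l l \<omega>) \<longlonglongrightarrow> L" "\<And>l. l \<ge> 1 \<Longrightarrow> L \<le> emp_entropy_seq_l l \<omega>"
    using block_entropy_limit by (auto simp: generic_emp_entropy_seq_l[OF assms])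
  then have "emp_entropy_seq \<omega> = L" unfolding emp_entropy_seq_def by (intro limI)
  with L show "(\<lambda>l. emp_entropy_seq_l l \<omega>) \<longlonglongrightarrow> emp_entropy_seq \<omega>"
    "l \<ge> 1 \<Longrightarrow> emp_entropy_seq \<omega> \<le> emp_entropy_seq_l l \<omega>" by auto
qed

text \<open>Jensen's inequality, by integrating the tangent line of \<open>eta\<close> at the mean
  of \<open>f\<close>.\<close>

lemma integral_eta_le:
  assumes [measurable]: "f \<in> borel_measurable \<mu>" and f: "\<And>\<omega>. 0 \<le> f \<omega>" "\<And>\<omega>. f \<omega> \<le> 1"
  shows "(\<integral>\<omega>. eta (f \<omega>) \<partial>\<mu>) \<le> eta (\<integral>\<omega>. f \<omega> \<partial>\<mu>)"
proof -
  define a where "a = (\<integral>\<omega>. f \<omega> \<partial>\<mu>)"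
  have int: "integrable \<mu> f" by (rule bounded_integrable[of _ 1]) (use f in auto)
  have int': "integrable \<mu> (\<lambda>\<omega>. eta (f \<omega>))"
    by (rule bounded_integrable[of _ "1 / ln 2"]) (use f eta_le eta_nonneg in auto)
  have a0: "0 \<le> a" unfolding a_def using f by (intro integral_nonneg_AE) auto
  show ?thesis
  proof (cases "a = 0")
    \<comment> \<open>At 0 the graph has infinite slope and no tangent line, but mean 0 forces
      \<open>f\<close> to vanish almost everywhere.\<close>
    case True
    then have "AE \<omega> in \<mu>. f \<omega> = 0"
      unfolding a_def using f int by (subst (asm) integral_nonneg_eq_0_iff_AE) auto
    then have "(\<integral>\<omega>. eta (f \<omega>) \<partial>\<mu>) = (\<integral>\<omega>. 0 \<partial>\<mu>)"
      by (intro integral_cong_AE) (auto elim!: eventually_mono)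
    then show ?thesis using True by (simp add: a_def)
  next
    case False
    then have a: "a > 0" using a0 by simp
    have "(\<integral>\<omega>. eta (f \<omega>) \<partial>\<mu>) \<le> (\<integral>\<omega>. - (f \<omega> * log 2 a) + (a - f \<omega>) / ln 2 \<partial>\<mu>)"
      using int int' a f by (intro integral_mono eta_le_cross) auto
    also have "\<dots> = - (a * log 2 a) + (a - a) / ln 2"
      using int by (simp add: a_def prob_space)
    finally show ?thesis by (simp add: eta_def a_def)
  qed
qed

lemma ent_prefix_of: "ent (itinerary first n) = (\<Sum>w\<in>words UNIV n. eta (\<integral>\<omega>. occurs w \<omega> \<partial>\<mu>))"
proof -
  have "ent (itinerary first n) = (\<Sum>w\<in>words UNIV n. eta (prob (itinerary first n -` {w} \<inter> space \<mu>)))"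
    by (intro entropy_eta simple_function_itinerary simple_function_first finite_words)
      (auto simp: words_UNIV)
  also have "\<dots> = (\<Sum>w\<in>words UNIV n. eta (\<integral>\<omega>. occurs w \<omega> \<partial>\<mu>))"
    by (intro sum.cong refl arg_cong[where f = eta])
      (auto simp: integral_occurs itinerary_first[abs_def] words_UNIV)
  finally show ?thesis .
qed

lemma emp_entropy_seq_l_measurable [measurable]: "emp_entropy_seq_l l \<in> borel_measurable \<mu>"
  unfolding emp_entropy_seq_l_eq[abs_def] by measurable

lemma emp_entropy_seq_measurable [measurable]: "emp_entropy_seq \<in> borel_measurable \<mu>"
  unfolding emp_entropy_seq_def[abs_def] by (rule borel_measurable_lim_metric) measurable

lemma
  fixes \<omega> :: "nat \<Rightarrow> 'a"
  shows emp_entropy_seq_l_nonneg: "0 \<le> emp_entropy_seq_l l \<omega>"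
    and emp_entropy_seq_l_le: "emp_entropy_seq_l l \<omega> \<le> real (card (words (UNIV :: 'a set) l)) * (1 / ln 2) / real l"
proof -
  have "eventually (\<lambda>n. 0 \<le> emp_entropy l (prefix_of \<omega> n)) sequentially"
    by (intro always_eventually allI emp_entropy_nonneg)
  moreover have "eventually (\<lambda>n. emp_entropy l (prefix_of \<omega> n) \<le>
      real (card (words (UNIV :: 'a set) l)) * (1 / ln 2) / real l) sequentially"
    by (intro always_eventually allI emp_entropy_le)
  ultimately show "0 \<le> emp_entropy_seq_l l \<omega>"
    "emp_entropy_seq_l l \<omega> \<le> real (card (words (UNIV :: 'a set) l)) * (1 / ln 2) / real l"
    unfolding emp_entropy_seq_l_eq by (rule rlimsup_ge, rule rlimsup_le)
qed

lemma integrable_emp_entropy_seq_l: "integrable \<mu> (emp_entropy_seq_l l)"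
proof (rule bounded_integrable)
  show "\<bar>emp_entropy_seq_l l \<omega>\<bar> \<le> real (card (words (UNIV :: 'a set) l)) * (1 / ln 2) / real l" for \<omega> :: "nat \<Rightarrow> 'a"
    using emp_entropy_seq_l_nonneg[of l \<omega>] emp_entropy_seq_l_le[of l \<omega>] by linarith
qed measurable

lemma generic_emp_entropy_seq_nonneg: "generic \<omega> \<Longrightarrow> 0 \<le> emp_entropy_seq \<omega>"
  by (rule LIMSEQ_le_const[OF generic_emp_entropy_seq(1)]) (simp_all add: emp_entropy_seq_l_nonneg)

lemma integrable_emp_entropy_seq: "integrable \<mu> emp_entropy_seq"
proof (rule Bochner_Integration.integrable_bound[OF integrable_emp_entropy_seq_l[of 1]])
  show "AE \<omega> in \<mu>. norm (emp_entropy_seq \<omega>) \<le> norm (emp_entropy_seq_l 1 \<omega>)"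
    using AE_generic
  proof eventually_elim
    case (elim \<omega>)
    then show ?case using generic_emp_entropy_seq_nonneg generic_emp_entropy_seq(2)[of \<omega> 1] by fastforce
  qed
qed measurable

lemma integral_emp_entropy_seq_le: "(\<integral>\<omega>. emp_entropy_seq \<omega> \<partial>\<mu>) \<le> entropy_rate first"
proof (rule LIMSEQ_le_const[OF entropy_rate_lim[OF simple_function_first]], intro exI allI impI)
  fix l :: nat assume l: "1 \<le> l"
  have int: "integrable \<mu> (\<lambda>\<omega>. eta (limit_freq \<omega> w))" for w
    by (rule bounded_integrable[of _ "1 / ln 2"]) (use eta_le eta_nonneg limit_freq_bounds in auto)
  have "(\<integral>\<omega>. emp_entropy_seq \<omega> \<partial>\<mu>) \<le> (\<integral>\<omega>. emp_entropy_seq_l l \<omega> \<partial>\<mu>)"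
    using AE_generic l generic_emp_entropy_seq(2)
    by (intro integral_mono_AE integrable_emp_entropy_seq integrable_emp_entropy_seq_l)
      (auto elim!: eventually_mono)
  also have "\<dots> = (\<integral>\<omega>. (\<Sum>w\<in>words UNIV l. eta (limit_freq \<omega> w)) / real l \<partial>\<mu>)"
    using AE_generic
    by (intro integral_cong_AE) (auto elim!: eventually_mono simp: generic_emp_entropy_seq_l block_entropy_def)
  also have "\<dots> = (\<Sum>w\<in>words UNIV l. \<integral>\<omega>. eta (limit_freq \<omega> w) \<partial>\<mu>) / real l"
    using int by (simp add: Bochner_Integration.integral_sum)
  \<comment> \<open>Jensen's inequality word by word for a fixed block length; by the integral part
    of Birkhoff's theorem the mean limiting frequency is then the probability of the word.\<close>
  also have "\<dots> \<le> (\<Sum>w\<in>words UNIV l. eta (\<integral>\<omega>. limit_freq \<omega> w \<partial>\<mu>)) / real l"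
    by (intro divide_right_mono sum_mono integral_eta_le limit_freq_bounds) auto
  also have "\<dots> = ent (itinerary first l) / real l"
    unfolding ent_prefix_of limit_freq_def
    using birkhoff(2)[OF occurs_measurable occurs_bounds] by simp
  finally show "(\<integral>\<omega>. emp_entropy_seq \<omega> \<partial>\<mu>) \<le> ent (itinerary first l) / real l" .
qed

lemma integral_of_prefix:
  fixes L :: "'a list \<Rightarrow> real"
  shows "(\<integral>\<omega>. L (prefix_of \<omega> n) \<partial>\<mu>) = (\<Sum>w\<in>words UNIV n. (\<integral>\<omega>. occurs w \<omega> \<partial>\<mu>) * L w)"
proof -
  have int: "integrable \<mu> (occurs w)" for w
    by (rule bounded_integrable[of _ 1]) (use occurs_bounds in auto)
  have "L (prefix_of \<omega> n) = (\<Sum>w\<in>words UNIV n. occurs w \<omega> * L w)" for \<omega>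
  proof -
    have "(\<Sum>w\<in>words UNIV n. occurs w \<omega> * L w) = (\<Sum>w\<in>words UNIV n. if w = prefix_of \<omega> n then L w else 0)"
      by (rule sum.cong) (auto simp: occurs_def words_UNIV)
    also have "\<dots> = L (prefix_of \<omega> n)"
      using finite_words[of "UNIV :: 'a set" n] by (simp add: words_UNIV)
    finally show ?thesis by simp
  qed
  then show ?thesis using int by (simp add: Bochner_Integration.integral_sum)
qed

text \<open>For fixed n the code length bound, applied to the law of the prefix, controls the mean
  code length from below; lengths are linear in n, so the logarithmic loss is o(n), and the reverse
  Fatou lemma moves the limsup inside the integral.\<close>

lemma entropy_rate_le_coding:
  fixes c :: "'a list \<Rightarrow> bool list"
  assumes inj: "inj c" and B: "\<And>s. s \<noteq> [] \<Longrightarrow> real (length (c s)) / real (length s) \<le> B"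
  shows "entropy_rate first \<le> (\<integral>\<omega>. rlimsup (\<lambda>n. real (length (c (prefix_of \<omega> n))) / real n) \<partial>\<mu>)"
proof -
  define K where "K = nat \<lceil>B\<rceil>"
  have len: "length (c s) \<le> K * n" if "length s = n" "n \<ge> 1" for s n
  proof -
    have "s \<noteq> []" using that by auto
    from B[OF this] have "real (length (c s)) / real n \<le> B" using that by simp
    also have "\<dots> \<le> real K" unfolding K_def by linarith
    finally have "real (length (c s)) \<le> real (K * n)" using that by (simp add: field_simps)
    then show ?thesis by linarith
  qed
  show ?thesis
  proof (rule integral_rlimsup_ge[where B = "max 0 B" and w = "\<lambda>n. log 2 (real K * real n + 1) / real n"])
    show "0 \<le> real (length (c (prefix_of \<omega> n))) / real n \<and>
        real (length (c (prefix_of \<omega> n))) / real n \<le> max 0 B" for n \<omega>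
    proof (cases "n = 0")
      case False
      then have "prefix_of \<omega> n \<noteq> []" by (metis length_prefix_of list.size(3))
      from B[OF this] show ?thesis by simp
    qed simp
    show "(\<lambda>n. log 2 (real K * real n + 1) / real n) \<longlonglongrightarrow> 0"
    \<comment> \<open>For \<open>K = 0\<close> the logarithm is log 1 = 0; the asymptotic argument
      handles positive \<open>K\<close>.\<close>
    proof (cases "K = 0")
      case False
      then show ?thesis unfolding log_def by real_asymp
    qed simp
    show "eventually (\<lambda>n. entropy_rate first \<le> (\<integral>\<omega>. real (length (c (prefix_of \<omega> n))) / real n \<partial>\<mu>) +
        log 2 (real K * real n + 1) / real n) sequentially"
      using eventually_ge_at_top[of 1]
    proof eventually_elim
      case (elim n)
      have "(\<Sum>w\<in>words UNIV n. (\<integral>\<omega>. occurs w \<omega> \<partial>\<mu>)) = 1"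
        using integral_of_prefix[of "\<lambda>_. 1" n] by (simp add: prob_space)
      then have "ent (itinerary first n) \<le>
          (\<Sum>w\<in>words UNIV n. (\<integral>\<omega>. occurs w \<omega> \<partial>\<mu>) * real (length (c w))) + log 2 (real (K * n) + 1)"
        unfolding ent_prefix_of
        by (intro entropy_le_code_length finite_words)
          (use inj len elim occurs_bounds in \<open>auto simp: words_UNIV inj_on_def intro!: integral_nonneg_AE\<close>)
      then have "ent (itinerary first n) \<le>
          (\<integral>\<omega>. real (length (c (prefix_of \<omega> n))) \<partial>\<mu>) + log 2 (real (K * n) + 1)"
        by (simp add: integral_of_prefix[of "\<lambda>w. real (length (c w))"])
      then have "ent (itinerary first n) / real n \<le>
          ((\<integral>\<omega>. real (length (c (prefix_of \<omega> n))) \<partial>\<mu>) + log 2 (real (K * n) + 1)) / real n"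
        by (intro divide_right_mono) auto
      with entropy_rate_le[OF simple_function_first elim] show ?case
        by (simp add: add_divide_distrib)
    qed
  qed (use borel_measurable_of_prefix in auto)
qed

end

theorem theorem3p8:
  fixes \<mu> :: "(nat \<Rightarrow> 'a::finite) measure"
    and Z :: "'a list \<Rightarrow> bool list"
    and C :: "bool list \<Rightarrow> 'a list option"
  assumes sets_mu: "sets \<mu> = sets (Pi\<^sub>M UNIV (\<lambda>_. count_space (UNIV :: 'a set)))"
    and prob: "prob_space \<mu>"
    and shift_meas: "shift \<in> measurable \<mu> \<mu>"
    and invariant: "\<forall>A \<in> sets \<mu>. emeasure \<mu> (shift -` A \<inter> space \<mu>) = emeasure \<mu> A"
    and univ: "universal_machine C"
    and opt: "optimal_coding Z"
  shows "K_Z Z \<in> borel_measurable \<mu> \<and> emp_entropy_seq \<in> borel_measurable \<mu>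
         \<and> K_AIC C \<in> borel_measurable \<mu>
         \<and> integrable \<mu> (K_Z Z) \<and> integrable \<mu> emp_entropy_seq \<and> integrable \<mu> (K_AIC C)
         \<and> ks_entropy \<mu> shift = ereal (integral\<^sup>L \<mu> (K_Z Z))
         \<and> ks_entropy \<mu> shift = ereal (integral\<^sup>L \<mu> emp_entropy_seq)
         \<and> ks_entropy \<mu> shift = ereal (integral\<^sup>L \<mu> (K_AIC C))"
proof -
  interpret prob_space \<mu> by (rule prob)
  have "distr \<mu> \<mu> shift = \<mu>"
    by (rule measure_eqI) (use shift_meas invariant in \<open>auto simp: emeasure_distr\<close>)
  then interpret stationary_source \<mu>
    using shift_meas sets_mu by unfold_locales auto
  obtain c where c: "\<And>s. \<exists>p. C p = Some s" "\<And>s. AIC C s \<le> length (Z s) + c"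
    using AIC_le_code_length[OF univ, of Z] opt unfolding optimal_coding_def by blast
  \<comment> \<open>A choice of shortest programs is an injective code, because \<open>C\<close>
    recovers the string.\<close>
  have "\<forall>s. \<exists>p. C p = Some s \<and> length p = AIC C s" using shortest_program[of C] c(1) by blast
  from choice[OF this] obtain P where P: "\<And>s. C (P s) = Some s" "\<And>s. length (P s) = AIC C s" by blast
  have injP: "inj P" by (rule injI) (metis P(1) option.inject)
  obtain B where B: "\<And>s. s \<noteq> [] \<Longrightarrow> real (length (Z s)) / real (length s) \<le> B"
    using optimal_coding_linear_bound[OF opt] by blast
  have boundZ: "real (length (Z (prefix_of \<omega> n))) / real n \<le> max 0 B" for \<omega> n
    using B[of "prefix_of \<omega> n"] by (cases "prefix_of \<omega> n = []") (auto dest: arg_cong[where f = length])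
  have boundP: "real (length (P s)) / real (length s) \<le> B + real c" if "s \<noteq> []" for s
  proof -
    have "real (length (P s)) / real (length s) \<le> (real (length (Z s)) + real c) / real (length s)"
      using c(2)[of s] P(2)[of s] by (intro divide_right_mono) auto
    also have "\<dots> = real (length (Z s)) / real (length s) + real c / real (length s)"
      by (rule add_divide_distrib)
    also have "real c / real (length s) \<le> real c / 1"
      using that by (intro divide_left_mono) (auto simp: Suc_le_eq)
    finally show ?thesis using B[OF that] by simp
  qed
  have K_AIC_P: "K_AIC C \<omega> = rlimsup (\<lambda>n. real (length (P (prefix_of \<omega> n))) / real n)" for \<omega>
    by (simp add: K_AIC_eq P(2))
  have K_AIC_le: "K_AIC C \<omega> \<le> K_Z Z \<omega>" for \<omega>
    unfolding K_AIC_eq K_Z_eq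
  proof (rule rlimsup_le_add[where a = 0 and b = "max 0 B" and w = "\<lambda>n. real c / real n"])
    show "(\<lambda>n. real c / real n) \<longlonglongrightarrow> 0" by (rule lim_const_over_n)
    show "eventually (\<lambda>n. real (AIC C (prefix_of \<omega> n)) / real n \<le>
        real (length (Z (prefix_of \<omega> n))) / real n + real c / real n) sequentially"
      using c(2) by (intro always_eventually allI)
        (metis add_divide_distrib divide_right_mono of_nat_0_le_iff of_nat_add of_nat_mono)
  qed (use boundZ in auto)
  have K_AIC_nonneg: "0 \<le> K_AIC C \<omega>" for \<omega>
    unfolding K_AIC_P
  proof (rule rlimsup_ge[where c = "B + real c"])
    show "eventually (\<lambda>n. real (length (P (prefix_of \<omega> n))) / real n \<le> B + real c) sequentially"
      using eventually_ge_at_top[of 1]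
    proof eventually_elim
      case (elim n)
      then have "prefix_of \<omega> n \<noteq> []" by (metis length_prefix_of list.size(3) not_one_le_zero)
      from boundP[OF this] show ?case by simp
    qed
  qed auto
  have meas: "K_Z Z \<in> borel_measurable \<mu>" "K_AIC C \<in> borel_measurable \<mu>"
    unfolding K_Z_eq[abs_def] K_AIC_eq[abs_def] by measurable
  have K_Z_le: "K_Z Z \<omega> \<le> emp_entropy_seq_l 1 \<omega>" for \<omega>
    using K_Z_le_emp_entropy_seq_l[OF opt] by simp
  \<comment> \<open>The empirical entropy of single letters is a bounded common majorant, which
    settles integrability.\<close>
  have norms: "norm (K_Z Z \<omega>) \<le> norm (emp_entropy_seq_l 1 \<omega>)" "norm (K_AIC C \<omega>) \<le> norm (emp_entropy_seq_l 1 \<omega>)" for \<omega>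
    using K_AIC_nonneg[of \<omega>] K_AIC_le[of \<omega>] K_Z_le[of \<omega>] unfolding real_norm_def by linarith+
  have int: "integrable \<mu> (K_Z Z)" "integrable \<mu> (K_AIC C)"
    by (rule Bochner_Integration.integrable_bound[OF integrable_emp_entropy_seq_l[of 1]],
        rule meas, rule AE_I2, rule norms)+
  \<comment> \<open>The bound by each block length holds everywhere; the limit over block lengths is
    available at generic sequences.\<close>
  have "AE \<omega> in \<mu>. K_Z Z \<omega> \<le> emp_entropy_seq \<omega>"
    using AE_generic
  proof eventually_elim
    case (elim \<omega>)
    from generic_emp_entropy_seq(1)[OF this] show ?case
      by (rule LIMSEQ_le_const) (use K_Z_le_emp_entropy_seq_l[OF opt] in auto)
  qed
  then have "integral\<^sup>L \<mu> (K_Z Z) \<le> integral\<^sup>L \<mu> emp_entropy_seq"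
    by (intro integral_mono_AE int integrable_emp_entropy_seq)
  moreover have "integral\<^sup>L \<mu> (K_AIC C) \<le> integral\<^sup>L \<mu> (K_Z Z)"
    by (intro integral_mono int K_AIC_le)
  \<comment> \<open>This link closes the cycle, and all four quantities coincide.\<close>
  moreover have "entropy_rate first \<le> integral\<^sup>L \<mu> (K_AIC C)"
    using entropy_rate_le_coding[OF injP boundP] by (simp add: K_AIC_P[abs_def])
  ultimately show ?thesis
    using integral_emp_entropy_seq_le meas int integrable_emp_entropy_seq emp_entropy_seq_measurable
    by (simp add: ks_entropy_eq_rate)
qed

end
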